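(* Let $\Gamma$ be a leaf-free bicyclic signed graph. Then $\eta(\Gamma)=2c(\Gamma)-1=3$ if and only if $\Gamma\cong \infty(l,k,x)$ or $\Gamma\cong\theta(l',x',k')$, where every cycle of $\Gamma$ has nullity $2$, and in the first case $x$ is odd, while in the second case $l',x',k'$ are all even.
   Context: A signed graph $\Gamma=(G,\sigma)$ is a simple finite graph $G$ with a map $\sigma:E(G)\to\{+,-\}$; its adjacency matrix has entry $\sigma(v_iv_j)$ if $v_i\sim v_j$ and $0$ otherwise; $\eta(\Gamma)$ is the multiplicity of the eigenvalue $0$ of this matrix. The nullity of a cycle of $\Gamma$ means the nullity of the signed cycle induced by it (with the signs inherited from $\Gamma$). $c(\Gamma)=|E(G)|-|V(G)|+\omega(G)$, where $\omega(G)$ is the number of connected components. Leaf-free means no vertex of degree one. A bicyclic (signed) graph is a connected one with $|E|=|V|+1$. The $\infty$-graph $\infty(p,q,l)$ is obtained from two vertex-disjoint cycles $C_p$ and $C_q$ by joining a vertex of $C_p$ and a vertex of $C_q$ by a path $P_l$ on $l$ vertices (length $l-1$; for $l=1$ the two vertices are identified). The $\theta$-graph $\theta(p,q,l)$ is the union of three internally disjoint paths of lengths $p,q,l$ with common end vertices, where $p,q,l\geq1$ and at most one of them equals $1$. Isomorphism here refers to the underlying graph, with arbitrary signs. *)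

theory Defs
  imports "Jordan_Normal_Form.Char_Poly"
begin

section \<open>Graphs and signed graphs\<close>

record 'a graph =
  verts :: "'a set"
  edges :: "'a set set"

datatype sign = Pos | Neg

fun sign_val :: "sign \<Rightarrow> real" where
  "sign_val Pos = 1"
| "sign_val Neg = -1"

text \<open>Only the values of the sign function on the edges are relevant.\<close>

record 'a signed_graph = "'a graph" +
  edge_sign :: "'a set \<Rightarrow> sign"

definition simple_graph :: "('a, 'm) graph_scheme \<Rightarrow> bool" where
  "simple_graph G \<longleftrightarrow> finite (verts G) \<and>
     (\<forall>e\<in>edges G. \<exists>u\<in>verts G. \<exists>v\<in>verts G. u \<noteq> v \<and> e = {u, v})"

definition degree_of :: "('a, 'm) graph_scheme \<Rightarrow> 'a \<Rightarrow> nat" where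
  "degree_of G v = card {e \<in> edges G. v \<in> e}"

definition leaf_free :: "('a, 'm) graph_scheme \<Rightarrow> bool" where
  "leaf_free G \<longleftrightarrow> (\<forall>v\<in>verts G. degree_of G v \<noteq> 1)"

definition conn_rel :: "('a, 'm) graph_scheme \<Rightarrow> 'a rel" where
  "conn_rel G = {(u, v). {u, v} \<in> edges G}\<^sup>* \<inter> verts G \<times> verts G"

definition components :: "('a, 'm) graph_scheme \<Rightarrow> 'a set set" where
  "components G = verts G // conn_rel G"

definition connected_graph :: "('a, 'm) graph_scheme \<Rightarrow> bool" where
  "connected_graph G \<longleftrightarrow> verts G \<noteq> {} \<and> (\<forall>u\<in>verts G. \<forall>v\<in>verts G. (u, v) \<in> conn_rel G)"

definition cyclomatic_number :: "('a, 'm) graph_scheme \<Rightarrow> int" where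
  "cyclomatic_number G =
     int (card (edges G)) - int (card (verts G)) + int (card (components G))"

definition bicyclic :: "('a, 'm) graph_scheme \<Rightarrow> bool" where
  "bicyclic G \<longleftrightarrow> connected_graph G \<and> card (edges G) = card (verts G) + 1"

definition graph_iso :: "('a, 'm) graph_scheme \<Rightarrow> ('b, 'n) graph_scheme \<Rightarrow> bool"
    (infix \<open>\<cong>\<^sub>G\<close> 50) where
  "G \<cong>\<^sub>G H \<longleftrightarrow> (\<exists>f. bij_betw f (verts G) (verts H) \<and>
     (\<forall>u\<in>verts G. \<forall>v\<in>verts G. {u, v} \<in> edges G \<longleftrightarrow> {f u, f v} \<in> edges H))"

section \<open>Nullity\<close>

definition adjacency_matrix :: "'a signed_graph \<Rightarrow> 'a list \<Rightarrow> real mat" where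
  "adjacency_matrix \<Gamma> vs = mat (length vs) (length vs) (\<lambda>(i, j).
     if {vs ! i, vs ! j} \<in> edges \<Gamma> then sign_val (edge_sign \<Gamma> {vs ! i, vs ! j}) else 0)"

definition nullity :: "'a signed_graph \<Rightarrow> nat" where
  "nullity \<Gamma> =
     order 0 (char_poly (adjacency_matrix \<Gamma> (SOME vs. distinct vs \<and> set vs = verts \<Gamma>)))"

text \<open>The enumeration of the vertices is immaterial.\<close>

lemma adjacency_matrix_similar:
  assumes "distinct vs" "distinct ws" "set vs = set ws"
  shows "similar_mat (adjacency_matrix \<Gamma> vs) (adjacency_matrix \<Gamma> ws)"
proof -
  define n where "n = length vs"
  have n: "length vs = n" "length ws = n"
    using assms by (simp_all add: n_def flip: distinct_card)
  define P :: "real mat" where "P = mat n n (\<lambda>(i, j). if vs ! i = ws ! j then 1 else 0)"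
  define Q :: "real mat" where "Q = mat n n (\<lambda>(i, j). if ws ! i = vs ! j then 1 else 0)"
  have ex1: "\<exists>j<n. ws ! j = vs ! i" "\<exists>j<n. vs ! j = ws ! i" if "i < n" for i
    using that assms(3) n by (metis in_set_conv_nth)+
  obtain f where f: "f i < n" "ws ! (f i) = vs ! i" if "i < n" for i
    using ex1(1) by metis
  obtain g where g: "g i < n" "vs ! (g i) = ws ! i" if "i < n" for i
    using ex1(2) by metis
  have feq: "vs ! i = ws ! k \<longleftrightarrow> k = f i" if "i < n" "k < n" for i k
    using f[OF that(1)] that assms(2) n by (metis nth_eq_iff_index_eq)
  have geq: "ws ! i = vs ! k \<longleftrightarrow> k = g i" if "i < n" "k < n" for i k
    using g[OF that(1)] that assms(1) n by (metis nth_eq_iff_index_eq)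
  have PM: "(P * M) $$ (i, j) = M $$ (f i, j)" if "i < n" "j < n" "M \<in> carrier_mat n n" for M i j
  proof -
    have "(P * M) $$ (i, j) = (\<Sum>k\<in>{0..<n}. P $$ (i, k) * M $$ (k, j))"
      using that by (simp add: P_def scalar_prod_def)
    also have "\<dots> = (\<Sum>k\<in>{0..<n}. if k = f i then M $$ (k, j) else 0)"
      by (rule sum.cong) (use that feq in \<open>auto simp: P_def\<close>)
    finally show ?thesis using f(1)[OF that(1)] by simp
  qed
  have QM: "(Q * M) $$ (i, j) = M $$ (g i, j)" if "i < n" "j < n" "M \<in> carrier_mat n n" for M i j
  proof -
    have "(Q * M) $$ (i, j) = (\<Sum>k\<in>{0..<n}. Q $$ (i, k) * M $$ (k, j))"
      using that by (simp add: Q_def scalar_prod_def)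
    also have "\<dots> = (\<Sum>k\<in>{0..<n}. if k = g i then M $$ (k, j) else 0)"
      by (rule sum.cong) (use that geq in \<open>auto simp: Q_def\<close>)
    finally show ?thesis using g(1)[OF that(1)] by simp
  qed
  have MQ: "(M * Q) $$ (i, j) = M $$ (i, f j)" if "i < n" "j < n" "M \<in> carrier_mat n n" for M i j
  proof -
    have "(M * Q) $$ (i, j) = (\<Sum>k\<in>{0..<n}. M $$ (i, k) * Q $$ (k, j))"
      using that by (simp add: Q_def scalar_prod_def)
    also have "\<dots> = (\<Sum>k\<in>{0..<n}. if k = f j then M $$ (i, k) else 0)"
      by (rule sum.cong) (use that feq in \<open>auto simp: Q_def eq_commute[of "ws ! _"]\<close>)
    finally show ?thesis using f(1)[OF that(2)] by simp
  qed
  have carr: "P \<in> carrier_mat n n" "Q \<in> carrier_mat n n"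
      "adjacency_matrix \<Gamma> vs \<in> carrier_mat n n" "adjacency_matrix \<Gamma> ws \<in> carrier_mat n n"
    by (simp_all add: P_def Q_def adjacency_matrix_def n)
  have "P * Q = 1\<^sub>m n"
    by (rule eq_matI)
      (use carr f assms(1) n in \<open>auto simp: PM Q_def nth_eq_iff_index_eq simp del: index_mult_mat(1)\<close>)
  moreover have "Q * P = 1\<^sub>m n"
    by (rule eq_matI)
      (use carr g assms(2) n in \<open>auto simp: QM P_def nth_eq_iff_index_eq simp del: index_mult_mat(1)\<close>)
  moreover have "adjacency_matrix \<Gamma> vs = P * adjacency_matrix \<Gamma> ws * Q"
  proof (rule eq_matI)
    fix i j
    assume "i < dim_row (P * adjacency_matrix \<Gamma> ws * Q)"
      "j < dim_col (P * adjacency_matrix \<Gamma> ws * Q)"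
    then have ij: "i < n" "j < n" using carr by auto
    have "(P * adjacency_matrix \<Gamma> ws * Q) $$ (i, j) = adjacency_matrix \<Gamma> ws $$ (f i, f j)"
      using ij f(1) carr by (simp add: MQ PM del: index_mult_mat(1))
    then show "adjacency_matrix \<Gamma> vs $$ (i, j) = (P * adjacency_matrix \<Gamma> ws * Q) $$ (i, j)"
      using ij f n by (simp add: adjacency_matrix_def)
  qed (use carr in auto)
  ultimately show ?thesis
    using carr by (intro similar_matI[of _ _ P Q n]) auto
qed

lemma nullity_eq:
  assumes "distinct vs" "set vs = verts \<Gamma>"
  shows "nullity \<Gamma> = order 0 (char_poly (adjacency_matrix \<Gamma> vs))"
proof -
  let ?ws = "SOME ws. distinct ws \<and> set ws = verts \<Gamma>"
  have "distinct ?ws \<and> set ?ws = verts \<Gamma>"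
    by (rule someI[of _ vs]) (use assms in blast)
  then have "similar_mat (adjacency_matrix \<Gamma> ?ws) (adjacency_matrix \<Gamma> vs)"
    using assms by (intro adjacency_matrix_similar) auto
  then show ?thesis
    unfolding nullity_def by (simp add: char_poly_similar)
qed

section \<open>Paths, cycles, and the two families of bicyclic graphs\<close>

definition path_edges :: "'a list \<Rightarrow> 'a set set" where
  "path_edges xs = {{xs ! i, xs ! Suc i} | i. Suc i < length xs}"

definition cycle_edges :: "'a list \<Rightarrow> 'a set set" where
  "cycle_edges xs = insert {last xs, hd xs} (path_edges xs)"

definition is_cycle :: "('a, 'm) graph_scheme \<Rightarrow> 'a list \<Rightarrow> bool" where
  "is_cycle G xs \<longleftrightarrow> 3 \<le> length xs \<and> distinct xs \<and> set xs \<subseteq> verts G \<and> cycle_edges xs \<subseteq> edges G"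

text \<open>The cycle as a signed graph of its own, without possible chords.\<close>

definition signed_cycle :: "'a signed_graph \<Rightarrow> 'a list \<Rightarrow> 'a signed_graph" where
  "signed_cycle \<Gamma> xs = \<lparr>verts = set xs, edges = cycle_edges xs, edge_sign = edge_sign \<Gamma>\<rparr>"

text \<open>The connecting path is 0, ..., l - 1; the two cycles are attached at its end vertices
  0 and l - 1, which coincide for l = 1.\<close>

definition infinity_graph :: "nat \<Rightarrow> nat \<Rightarrow> nat \<Rightarrow> nat graph" where
  "infinity_graph p q l =
     \<lparr>verts = {0..<p + q + l - 2},
      edges = path_edges [0..<l] \<union> cycle_edges (0 # [l..<l + p - 1])
        \<union> cycle_edges ((l - 1) # [l + p - 1..<l + p + q - 2])\<rparr>"

definition infinity_params :: "nat \<Rightarrow> nat \<Rightarrow> nat \<Rightarrow> bool" where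
  "infinity_params p q l \<longleftrightarrow> 3 \<le> p \<and> 3 \<le> q \<and> 1 \<le> l"

text \<open>The common end vertices of the three paths are 0 and 1.\<close>

definition theta_graph :: "nat \<Rightarrow> nat \<Rightarrow> nat \<Rightarrow> nat graph" where
  "theta_graph p q l =
     \<lparr>verts = {0..<p + q + l - 1},
      edges = path_edges (0 # [2..<p + 1] @ [1]) \<union> path_edges (0 # [p + 1..<p + q] @ [1])
        \<union> path_edges (0 # [p + q..<p + q + l - 1] @ [1])\<rparr>"

definition theta_params :: "nat \<Rightarrow> nat \<Rightarrow> nat \<Rightarrow> bool" where
  "theta_params p q l \<longleftrightarrow> 1 \<le> p \<and> 1 \<le> q \<and> 1 \<le> l \<and>
     \<not> (p = 1 \<and> q = 1) \<and> \<not> (p = 1 \<and> l = 1) \<and> \<not> (q = 1 \<and> l = 1)"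

end

theory Submission
  imports Defs
begin

text \<open>
  The multiplicity of 0 as a root of the characteristic polynomial of a symmetric matrix is the
  dimension of its kernel, i.e. the size of a set of coordinates on which kernel vectors can be
  prescribed arbitrarily and by which they are determined.

  Every cycle of a leaf-free bicyclic graph is, up to rotation, an initial segment
  \<open>v\<^sub>0 \<dots> v\<^sub>i\<close> of a Hamiltonian path \<open>v\<^sub>0 \<dots> v\<^sub>n\<close> such that the only
  edges off the path are \<open>v\<^sub>0v\<^sub>i\<close> and \<open>v\<^sub>nv\<^sub>j\<close>: extend the cycle to a maximal path,
  and compare degree sums. The graph is an \<open>\<infinity>\<close>-graph if \<open>i \<le> j\<close> and a
  \<open>\<theta>\<close>-graph otherwise.

  A kernel vector is determined by its values at \<open>v\<^sub>0\<close>, \<open>v\<^sub>1\<close>, \<open>v\<^sub>n\<close>, so the nullity is 3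
  iff these values are free. The vector with values \<open>0, \<plusminus>1, 0\<close> alternates along the path, and
  its equations at \<open>v\<^sub>0\<close> and \<open>v\<^sub>n\<close> say precisely that the cycles
  \<open>v\<^sub>0 \<dots> v\<^sub>i\<close> and \<open>v\<^sub>j \<dots> v\<^sub>n\<close> have nullity 2 and that \<open>i + j\<close> is even;
  conversely, these conditions make all three values free.
\<close>

section \<open>Nullity as kernel dimension\<close>

lemma char_poly_block_upper:
  fixes B :: "'a :: idom mat"
  assumes B: "B \<in> carrier_mat k k" and C: "C \<in> carrier_mat k m" and D: "D \<in> carrier_mat m m"
  shows "char_poly (four_block_mat B C (0\<^sub>m m k) D) = char_poly B * char_poly D"
proof -
  have "char_poly_matrix (four_block_mat B C (0\<^sub>m m k) D) =
      four_block_mat (char_poly_matrix B) (map_mat (\<lambda>a. [:- a:]) C) (0\<^sub>m m k) (char_poly_matrix D)"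
    by (rule eq_matI) (use assms in \<open>auto simp: char_poly_matrix_def\<close>)
  then show ?thesis
    unfolding char_poly_def
    by (simp add: det_four_block_mat_lower_left_zero[of _ k _ m] assms)
qed

lemma char_poly_zero_mat: "char_poly (0\<^sub>m k k :: 'a :: comm_ring_1 mat) = monom 1 k"
proof -
  have "char_poly (0\<^sub>m k k :: 'a mat) = (\<Prod>a\<leftarrow>diag_mat (0\<^sub>m k k). [:- a, 1:])"
    by (rule char_poly_upper_triangular[of _ k]) auto
  also have "diag_mat (0\<^sub>m k k :: 'a mat) = replicate k 0"
    by (auto simp: diag_mat_def list_eq_iff_nth_eq)
  also have "(\<Prod>a\<leftarrow>replicate k (0 :: 'a). [:- a, 1:]) = monom 1 k"
    by (simp add: monom_altdef)
  finally show ?thesis .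
qed

text \<open>The block columns made of \<open>1\<^sub>m k\<close> and \<open>B\<close> are kernel
  vectors of \<open>A\<close>; taking them as the first basis vectors makes \<open>A\<close> block
  upper triangular with a zero block of size \<open>k\<close>. Symmetry excludes nilpotent parts, so
  0 is no eigenvalue of the remaining block \<open>C\<close>, and the order is exactly
  \<open>k\<close>.\<close>

lemma order_0_char_poly_symmetric:
  fixes A1 A2 A3 A4 B :: "real mat"
  defines "A \<equiv> four_block_mat A1 A2 A3 A4"
  assumes A1: "A1 \<in> carrier_mat k k" and A2: "A2 \<in> carrier_mat k m"
    and A3: "A3 \<in> carrier_mat m k" and A4: "A4 \<in> carrier_mat m m" and B: "B \<in> carrier_mat m k"
    and sym: "transpose_mat A = A"
    and ker1: "A1 + A2 * B = 0\<^sub>m k k" and ker2: "A3 + A4 * B = 0\<^sub>m m k"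
    and inj: "\<And>y. y \<in> carrier_vec m \<Longrightarrow> A2 *\<^sub>v y = 0\<^sub>v k \<Longrightarrow> A4 *\<^sub>v y = 0\<^sub>v m \<Longrightarrow> y = 0\<^sub>v m"
  shows "order 0 (char_poly A) = k"
proof -
  define P where "P = four_block_mat (1\<^sub>m k) (0\<^sub>m k m) B (1\<^sub>m m)"
  define Q where "Q = four_block_mat (1\<^sub>m k) (0\<^sub>m k m) (- B) (1\<^sub>m m)"
  define C where "C = - B * A2 + A4"
  define N where "N = four_block_mat (0\<^sub>m k k) A2 (0\<^sub>m m k) C"
  have C: "C \<in> carrier_mat m m" using A2 A4 B by (simp add: C_def)
  have carr: "P \<in> carrier_mat (k+m) (k+m)" "Q \<in> carrier_mat (k+m) (k+m)"
    "A \<in> carrier_mat (k+m) (k+m)" "N \<in> carrier_mat (k+m) (k+m)"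
    using A1 A2 A3 A4 B C by (auto simp: P_def Q_def A_def N_def)
  have mB: "- B \<in> carrier_mat m k" using B by simp
  have PQ: "P * Q = 1\<^sub>m (k+m)"
    unfolding P_def Q_def
    by (subst mult_four_block_mat[OF one_carrier_mat zero_carrier_mat B one_carrier_mat
          one_carrier_mat zero_carrier_mat mB one_carrier_mat])
      (rule eq_matI, use B in auto)
  have QP: "Q * P = 1\<^sub>m (k+m)"
    unfolding P_def Q_def
    by (subst mult_four_block_mat[OF one_carrier_mat zero_carrier_mat mB one_carrier_mat
          one_carrier_mat zero_carrier_mat B one_carrier_mat])
      (rule eq_matI, use B in auto)
  have AP: "A * P = four_block_mat (0\<^sub>m k k) A2 (0\<^sub>m m k) A4"
    unfolding A_def P_def
    by (subst mult_four_block_mat[OF A1 A2 A3 A4 one_carrier_mat zero_carrier_mat B one_carrier_mat])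
      (use A1 A2 A3 A4 ker1 ker2 in simp)
  have QAP: "Q * (A * P) = N"
    unfolding AP Q_def N_def C_def
    by (subst mult_four_block_mat[OF one_carrier_mat zero_carrier_mat mB one_carrier_mat
          zero_carrier_mat A2 zero_carrier_mat A4]) (use A2 A4 B in simp)
  have "N = Q * A * P"
    using QAP carr by (simp add: assoc_mult_mat[of _ "k+m" "k+m" _ "k+m" _ "k+m"])
  then have "similar_mat N A"
    using PQ QP carr by (intro similar_matI[of _ _ Q P "k+m"]) auto
  then have "char_poly A = char_poly N" by (simp add: char_poly_similar)
  also have "\<dots> = monom 1 k * char_poly C"
    unfolding N_def using A2 C by (simp add: char_poly_block_upper char_poly_zero_mat)
  finally have cp: "char_poly A = monom 1 k * char_poly C" .
  have "poly (char_poly C) 0 \<noteq> 0"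
  proof
    assume "poly (char_poly C) 0 = 0"
    then have "eigenvalue C 0" using eigenvalue_root_char_poly[OF C] by simp
    then obtain y where y: "y \<in> carrier_vec m" "y \<noteq> 0\<^sub>v m" "C *\<^sub>v y = 0 \<cdot>\<^sub>v y"
      using C by (auto simp: eigenvalue_def eigenvector_def)
    define u where "u = A2 *\<^sub>v y"
    define w where "w = A4 *\<^sub>v y"
    have u: "u \<in> carrier_vec k" and w: "w \<in> carrier_vec m"
      using A2 A4 y by (auto simp: u_def w_def)
    have "C *\<^sub>v y = - (B *\<^sub>v u) + w"
      unfolding C_def u_def w_def using A2 A4 B y
      by (simp add: add_mult_distrib_mat_vec[of _ m m] uminus_mult_mat_vec assoc_mult_mat_vec[of _ m k _ m])
    then have e: "- (B *\<^sub>v u) + w = 0 \<cdot>\<^sub>v y" using y(3) by simp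
    \<comment> \<open>The vector \<open>C *\<^sub>v y\<close> being zero says that \<open>A\<close>
      maps the vector with blocks 0 and \<open>y\<close> to the one with blocks \<open>u\<close> and
      \<open>B *\<^sub>v u\<close>. By \<open>ker1\<close> and \<open>ker2\<close> the latter is
      again in the kernel of \<open>A\<close>.\<close>
    have wB: "w = B *\<^sub>v u"
    proof (rule eq_vecI)
      fix i assume "i < dim_vec (B *\<^sub>v u)"
      then show "w $ i = (B *\<^sub>v u) $ i"
        using arg_cong[OF e, of "\<lambda>z. z $ i"] w B y(1) by simp
    qed (use w B in simp)
    have z0: "A1 *\<^sub>v 0\<^sub>v k = 0\<^sub>v k" "A3 *\<^sub>v 0\<^sub>v k = 0\<^sub>v m"
      using A1 A3 by (auto intro!: eq_vecI simp: scalar_prod_def)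
    have z: "A *\<^sub>v (0\<^sub>v k @\<^sub>v y) = u @\<^sub>v w"
      unfolding A_def
      by (subst four_block_mat_mult_vec[OF A1 A2 A3 A4 zero_carrier_vec y(1)])
        (use A2 A4 y in \<open>auto simp: z0 u_def w_def\<close>)
    have "A1 *\<^sub>v u + A2 *\<^sub>v w = (A1 + A2 * B) *\<^sub>v u" "A3 *\<^sub>v u + A4 *\<^sub>v w = (A3 + A4 * B) *\<^sub>v u"
      unfolding wB using A1 A2 A3 A4 B u
      by (simp_all add: add_mult_distrib_mat_vec[of _ k k] add_mult_distrib_mat_vec[of _ m k]
          assoc_mult_mat_vec[of _ k m _ k] assoc_mult_mat_vec[of _ m m _ k])
    then have uw0: "A *\<^sub>v (u @\<^sub>v w) = 0\<^sub>v (k+m)"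
      unfolding A_def
      by (subst four_block_mat_mult_vec[OF A1 A2 A3 A4 u w])
        (use u ker1 ker2 in auto)
    \<comment> \<open>Writing z for the vector with blocks 0 and \<open>y\<close>, symmetry gives Az
      . Az = A(Az) . z = 0, so Az = 0 over the reals.\<close>
    have "(u @\<^sub>v w) \<bullet> (u @\<^sub>v w) = (transpose_mat A *\<^sub>v (u @\<^sub>v w)) \<bullet> (0\<^sub>v k @\<^sub>v y)"
      by (subst transpose_vec_mult_scalar[OF carr(3)]) (use u w y z in auto)
    also have "\<dots> = 0" using uw0 sym y(1) by simp
    finally have "u @\<^sub>v w = 0\<^sub>v (k+m)"
      using u w conjugate_square_eq_0_vec[of "u @\<^sub>v w" "k + m"] by simp
    also have "\<dots> = 0\<^sub>v k @\<^sub>v 0\<^sub>v m" by auto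
    finally have "u = 0\<^sub>v k" "w = 0\<^sub>v m"
      using append_vec_eq[OF u zero_carrier_vec, of w "0\<^sub>v m"] by auto
    with inj y show False by (simp add: u_def w_def)
  qed
  then have "order 0 (char_poly C) = 0" "char_poly C \<noteq> 0"
    by (auto simp: order_root)
  then show ?thesis
    using order_power_n_n[of 0 k] by (simp add: cp order_mult monom_altdef)
qed

section \<open>Kernel vectors as functions on the vertices\<close>

definition signed_row :: "'a set \<Rightarrow> 'a set set \<Rightarrow> ('a set \<Rightarrow> real) \<Rightarrow> ('a \<Rightarrow> real) \<Rightarrow> 'a \<Rightarrow> real" where
  "signed_row V E s x v = (\<Sum>u\<in>V. if {v, u} \<in> E then s {v, u} * x u else 0)"

definition in_kernel :: "'a signed_graph \<Rightarrow> ('a \<Rightarrow> real) \<Rightarrow> bool" where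
  "in_kernel \<Gamma> x \<longleftrightarrow>
     (\<forall>v\<in>verts \<Gamma>. signed_row (verts \<Gamma>) (edges \<Gamma>) (\<lambda>e. sign_val (edge_sign \<Gamma> e)) x v = 0)"

definition kernel_determined :: "'a signed_graph \<Rightarrow> 'a set \<Rightarrow> bool" where
  "kernel_determined \<Gamma> S \<longleftrightarrow>
     (\<forall>x. in_kernel \<Gamma> x \<longrightarrow> (\<forall>s\<in>S. x s = 0) \<longrightarrow> (\<forall>v\<in>verts \<Gamma>. x v = 0))"

lemma sum_nth_distinct:
  assumes "distinct xs"
  shows "(\<Sum>u\<in>set xs. f u) = (\<Sum>i = 0..<length xs. f (xs ! i))"
  by (rule sum.reindex_bij_betw[OF bij_betw_nth, symmetric]) (use assms in auto)

text \<open>Listing the vertices of \<open>S\<close> first puts the adjacency matrix into the block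
  form of \<open>order_0_char_poly_symmetric\<close>: the kernel vectors from \<open>ex\<close>,
  restricted to the other vertices, are the columns of \<open>B\<close>, and \<open>det\<close> is
  the injectivity condition.\<close>

lemma nullity_eq_cardI:
  assumes fin: "finite (verts \<Gamma>)" and S: "S \<subseteq> verts \<Gamma>"
    and det: "kernel_determined \<Gamma> S"
    and ex: "\<And>s. s \<in> S \<Longrightarrow> \<exists>x. in_kernel \<Gamma> x \<and> x s = 1 \<and> (\<forall>t\<in>S - {s}. x t = 0)"
  shows "nullity \<Gamma> = card S"
proof -
  define T where "T = verts \<Gamma> - S"
  obtain ss where ss: "distinct ss" "set ss = S"
    using finite_distinct_list finite_subset[OF S fin] by blast
  obtain ts where ts: "distinct ts" "set ts = T"
    using finite_distinct_list[of T] fin by (auto simp: T_def)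
  define k m where "k = length ss" and "m = length ts"
  define w where
    "w v u = (if {v, u} \<in> edges \<Gamma> then sign_val (edge_sign \<Gamma> {v, u}) else 0)" for v u
  have row: "signed_row (verts \<Gamma>) (edges \<Gamma>) (\<lambda>e. sign_val (edge_sign \<Gamma> e)) x v =
      (\<Sum>i = 0..<k. w v (ss ! i) * x (ss ! i)) + (\<Sum>i = 0..<m. w v (ts ! i) * x (ts ! i))" for x v
  proof -
    have "signed_row (verts \<Gamma>) (edges \<Gamma>) (\<lambda>e. sign_val (edge_sign \<Gamma> e)) x v =
        (\<Sum>u\<in>S \<union> T. w v u * x u)"
      unfolding signed_row_def using S by (intro sum.cong) (auto simp: w_def T_def)
    also have "\<dots> = (\<Sum>u\<in>S. w v u * x u) + (\<Sum>u\<in>T. w v u * x u)"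
      using fin finite_subset[OF S fin] by (intro sum.union_disjoint) (auto simp: T_def)
    also have "\<dots> = (\<Sum>i = 0..<k. w v (ss ! i) * x (ss ! i)) + (\<Sum>i = 0..<m. w v (ts ! i) * x (ts ! i))"
      unfolding k_def m_def ss(2)[symmetric] ts(2)[symmetric]
      by (intro arg_cong2[where f = "(+)"] sum_nth_distinct ss ts)
    finally show ?thesis .
  qed
  have "\<forall>s\<in>S. \<exists>x. in_kernel \<Gamma> x \<and> x s = 1 \<and> (\<forall>t\<in>S - {s}. x t = 0)"
    using ex by blast
  from bchoice[OF this] obtain b where
    "\<forall>s\<in>S. in_kernel \<Gamma> (b s) \<and> b s s = 1 \<and> (\<forall>t\<in>S - {s}. b s t = 0)" ..
  then have b: "in_kernel \<Gamma> (b s)" "b s s = 1" "t \<in> S - {s} \<Longrightarrow> b s t = 0" if "s \<in> S" for s t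
    using that by auto
  define A1 where "A1 = mat k k (\<lambda>(i, j). w (ss ! i) (ss ! j))"
  define A2 where "A2 = mat k m (\<lambda>(i, j). w (ss ! i) (ts ! j))"
  define A3 where "A3 = mat m k (\<lambda>(i, j). w (ts ! i) (ss ! j))"
  define A4 where "A4 = mat m m (\<lambda>(i, j). w (ts ! i) (ts ! j))"
  define B where "B = mat m k (\<lambda>(i, j). b (ss ! j) (ts ! i))"
  have carr: "A1 \<in> carrier_mat k k" "A2 \<in> carrier_mat k m" "A3 \<in> carrier_mat m k"
    "A4 \<in> carrier_mat m m" "B \<in> carrier_mat m k"
    by (auto simp: A1_def A2_def A3_def A4_def B_def)
  have A: "adjacency_matrix \<Gamma> (ss @ ts) = four_block_mat A1 A2 A3 A4"
    by (rule eq_matI)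
      (auto simp: adjacency_matrix_def A1_def A2_def A3_def A4_def k_def m_def w_def nth_append)
  have ssS: "ss ! i \<in> S" "ss ! i \<in> verts \<Gamma>" if "i < k" for i
    using that ss S by (auto simp: k_def)
  have tsT: "ts ! i \<in> T" "ts ! i \<in> verts \<Gamma>" if "i < m" for i
    using that ts nth_mem[of i ts] by (auto simp: m_def T_def)
  have key: "w v (ss ! j) + (\<Sum>i = 0..<m. w v (ts ! i) * b (ss ! j) (ts ! i)) = 0"
    if "v \<in> verts \<Gamma>" "j < k" for v j
  proof -
    have "(\<Sum>i = 0..<k. w v (ss ! i) * b (ss ! j) (ss ! i)) =
        (\<Sum>i = 0..<k. if i = j then w v (ss ! j) else 0)"
      using ss ssS that b(2)[of "ss ! j"] b(3)[of "ss ! j"]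
      by (intro sum.cong) (auto simp: nth_eq_iff_index_eq k_def)
    then have "(\<Sum>i = 0..<k. w v (ss ! i) * b (ss ! j) (ss ! i)) = w v (ss ! j)"
      using that by simp
    moreover have "signed_row (verts \<Gamma>) (edges \<Gamma>) (\<lambda>e. sign_val (edge_sign \<Gamma> e)) (b (ss ! j)) v = 0"
      using b(1)[OF ssS(1)[OF that(2)]] that(1) by (simp add: in_kernel_def)
    ultimately show ?thesis unfolding row by simp
  qed
  have "order 0 (char_poly (four_block_mat A1 A2 A3 A4)) = k"
  proof (rule order_0_char_poly_symmetric[OF carr])
    show "transpose_mat (four_block_mat A1 A2 A3 A4) = four_block_mat A1 A2 A3 A4"
      unfolding A[symmetric]
      by (rule eq_matI) (auto simp: adjacency_matrix_def insert_commute)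
    show "A1 + A2 * B = 0\<^sub>m k k"
      by (rule eq_matI)
        (use carr ssS in \<open>auto simp: A1_def A2_def B_def scalar_prod_def key\<close>)
    show "A3 + A4 * B = 0\<^sub>m m k"
      by (rule eq_matI)
        (use carr tsT in \<open>auto simp: A3_def A4_def B_def scalar_prod_def key\<close>)
  next
    fix y :: "real vec"
    assume y: "y \<in> carrier_vec m" "A2 *\<^sub>v y = 0\<^sub>v k" "A4 *\<^sub>v y = 0\<^sub>v m"
    \<comment> \<open>The vector \<open>y\<close> is extended by zero to \<open>S\<close>; the two
      matrix equations then say that the result is a kernel vector.\<close>
    define x where "x u = (if u \<in> T then y $ inv_into {0..<m} ((!) ts) u else 0)" for u
    have inj: "inj_on ((!) ts) {0..<m}"
      using ts by (auto intro!: inj_on_nth simp: m_def)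
    have xt: "x (ts ! i) = y $ i" if "i < m" for i
      using that tsT inv_into_f_f[OF inj] by (simp add: x_def)
    have xs: "x s = 0" if "s \<in> S" for s using that by (simp add: x_def T_def)
    have "signed_row (verts \<Gamma>) (edges \<Gamma>) (\<lambda>e. sign_val (edge_sign \<Gamma> e)) x v = 0"
      if v: "v \<in> verts \<Gamma>" for v
    proof -
      have r: "signed_row (verts \<Gamma>) (edges \<Gamma>) (\<lambda>e. sign_val (edge_sign \<Gamma> e)) x v =
          (\<Sum>i = 0..<m. w v (ts ! i) * y $ i)"
        unfolding row using xt xs ssS by simp
      show ?thesis
      proof (cases "v \<in> S")
        case True
        then obtain j where "j < k" "v = ss ! j" using ss by (auto simp: k_def in_set_conv_nth)
        then show ?thesis
          using arg_cong[OF y(2), of "\<lambda>z. z $ j"] y(1) unfolding r by (simp add: A2_def scalar_prod_def)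
      next
        case False
        then obtain j where "j < m" "v = ts ! j"
          using ts v by (metis DiffI T_def in_set_conv_nth m_def)
        then show ?thesis
          using arg_cong[OF y(3), of "\<lambda>z. z $ j"] y(1) unfolding r by (simp add: A4_def scalar_prod_def)
      qed
    qed
    then have "x v = 0" if "v \<in> verts \<Gamma>" for v
      using det xs that by (auto simp: kernel_determined_def in_kernel_def)
    then have "y $ i = 0" if "i < m" for i using xt[OF that] tsT(2)[OF that] by simp
    then show "y = 0\<^sub>v m" using y(1) by (intro eq_vecI) auto
  qed
  moreover have "distinct (ss @ ts)" "set (ss @ ts) = verts \<Gamma>"
    using ss ts S by (auto simp: T_def)
  ultimately show ?thesis
    using nullity_eq[of "ss @ ts" \<Gamma>] A distinct_card[OF ss(1)] ss(2) by (simp add: k_def)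
qed

lemma signed_row_cmult: "signed_row V E s (\<lambda>u. c * x u) v = c * signed_row V E s x v"
  unfolding signed_row_def sum_distrib_left by (rule sum.cong) auto

lemma signed_row_sum:
  "signed_row V E s (\<lambda>u. \<Sum>i\<in>I. x i u) v = (\<Sum>i\<in>I. signed_row V E s (x i) v)"
  unfolding signed_row_def by (subst sum.swap, rule sum.cong) (auto simp: sum_distrib_left)

text \<open>An inclusion-minimal determining subset of \<open>S\<close> carries a dual basis of the kernel.\<close>

lemma nullity_eq_card_iff:
  assumes fin: "finite (verts \<Gamma>)" and S: "S \<subseteq> verts \<Gamma>" and det: "kernel_determined \<Gamma> S"
  shows "nullity \<Gamma> = card S \<longleftrightarrow> (\<forall>c. \<exists>x. in_kernel \<Gamma> x \<and> (\<forall>s\<in>S. x s = c s))"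
proof
  assume ext: "\<forall>c. \<exists>x. in_kernel \<Gamma> x \<and> (\<forall>s\<in>S. x s = c s)"
  show "nullity \<Gamma> = card S"
  proof (rule nullity_eq_cardI[OF fin S det])
    fix s assume "s \<in> S"
    moreover obtain x where "in_kernel \<Gamma> x" "\<forall>t\<in>S. x t = (if t = s then 1 else 0)"
      using ext[rule_format, of "\<lambda>t. if t = s then 1 else 0"] by blast
    ultimately show "\<exists>x. in_kernel \<Gamma> x \<and> x s = 1 \<and> (\<forall>t\<in>S - {s}. x t = 0)"
      by (intro exI[of _ x]) auto
  qed
next
  assume null: "nullity \<Gamma> = card S"
  have finS: "finite S" using S fin by (rule finite_subset)
  obtain S' where S': "S' \<subseteq> S" "kernel_determined \<Gamma> S'"
    and min: "\<And>R. R \<subseteq> S' \<Longrightarrow> kernel_determined \<Gamma> R \<Longrightarrow> R = S'"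
  proof -
    define F where "F = {R. R \<subseteq> S \<and> kernel_determined \<Gamma> R}"
    have "finite F" "S \<in> F" using finS det by (auto simp: F_def)
    from finite_has_minimal2[OF this] obtain S' where "S' \<in> F" "\<forall>R\<in>F. R \<subseteq> S' \<longrightarrow> S' = R"
      by blast
    then show ?thesis using that[of S'] by (auto simp: F_def)
  qed
  \<comment> \<open>By minimality some kernel vector vanishes on \<open>S' - {s}\<close> but not
    everywhere. It cannot vanish at \<open>s\<close>, so it can be scaled to the value 1
    there.\<close>
  have unit: "\<exists>x. in_kernel \<Gamma> x \<and> x s = 1 \<and> (\<forall>t\<in>S' - {s}. x t = 0)" if s: "s \<in> S'" for s
  proof -
    have "\<not> kernel_determined \<Gamma> (S' - {s})" using min[of "S' - {s}"] s by blast
    then obtain x v where x: "in_kernel \<Gamma> x" "\<forall>t\<in>S' - {s}. x t = 0" "v \<in> verts \<Gamma>" "x v \<noteq> 0"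
      by (auto simp: kernel_determined_def)
    have "x s \<noteq> 0" using S'(2) x unfolding kernel_determined_def by blast
    moreover have "in_kernel \<Gamma> (\<lambda>u. inverse (x s) * x u)"
      using x(1) by (simp add: in_kernel_def signed_row_cmult)
    ultimately show ?thesis using x by (intro exI[of _ "\<lambda>u. inverse (x s) * x u"]) auto
  qed
  have "nullity \<Gamma> = card S'"
    using nullity_eq_cardI[OF fin _ S'(2) unit] S S' by auto
  \<comment> \<open>The nullity is both \<open>card S'\<close> and \<open>card S\<close>, so the
    minimal set is all of \<open>S\<close> and the vectors from \<open>unit\<close> are a basis dual
    to \<open>S\<close>.\<close>
  then have "S' = S" using null S'(1) finS by (metis card_subset_eq)
  show "\<forall>c. \<exists>x. in_kernel \<Gamma> x \<and> (\<forall>s\<in>S. x s = c s)"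
  proof
    fix c :: "'a \<Rightarrow> real"
    have "\<forall>s\<in>S. \<exists>x. in_kernel \<Gamma> x \<and> x s = 1 \<and> (\<forall>t\<in>S - {s}. x t = 0)"
      using unit \<open>S' = S\<close> by blast
    from bchoice[OF this] obtain b where
      b: "\<forall>s\<in>S. in_kernel \<Gamma> (b s) \<and> b s s = 1 \<and> (\<forall>t\<in>S - {s}. b s t = 0)" ..
    define x where "x u = (\<Sum>s\<in>S. c s * b s u)" for u
    have "in_kernel \<Gamma> x"
      using b unfolding in_kernel_def x_def signed_row_sum signed_row_cmult by simp
    moreover have "x t = c t" if "t \<in> S" for t
    proof -
      have "x t = (\<Sum>s\<in>S. if s = t then c t else 0)"
        unfolding x_def using b that by (intro sum.cong) auto
      then show ?thesis using that finS by simp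
    qed
    ultimately show "\<exists>x. in_kernel \<Gamma> x \<and> (\<forall>s\<in>S. x s = c s)" by blast
  qed
qed

section \<open>Kernel equations along a path\<close>

lemma path_edges_nth_iff:
  assumes "distinct vs" "k < length vs" "m < length vs"
  shows "{vs ! k, vs ! m} \<in> path_edges vs \<longleftrightarrow> m = Suc k \<or> k = Suc m"
  using assms by (fastforce simp: path_edges_def doubleton_eq_iff nth_eq_iff_index_eq)

text \<open>Allows kernel equations to be built up from a path by adding one chord at a time; for
  this reason \<open>signed_row\<close> takes the edge set as a separate argument.\<close>

lemma signed_row_insert:
  assumes "finite V" "p \<in> V" "q \<in> V" "p \<noteq> q" "{p, q} \<notin> E"
  shows "signed_row V (insert {p, q} E) s x v =
    signed_row V E s x v + (if v = p then s {p, q} * x q else 0) + (if v = q then s {p, q} * x p else 0)"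
proof -
  have "signed_row V (insert {p, q} E) s x v =
      (\<Sum>u\<in>V. (if {v, u} \<in> E then s {v, u} * x u else 0) +
        ((if u = q then if v = p then s {p, q} * x q else 0 else 0) +
         (if u = p then if v = q then s {p, q} * x p else 0 else 0)))"
    unfolding signed_row_def
    by (rule sum.cong) (use assms in \<open>auto simp: doubleton_eq_iff insert_commute\<close>)
  also have "\<dots> = signed_row V E s x v +
      ((if v = p then s {p, q} * x q else 0) + (if v = q then s {p, q} * x p else 0))"
    unfolding sum.distrib signed_row_def using assms by simp
  finally show ?thesis by simp
qed

lemma signed_row_path:
  assumes "distinct vs" "k < length vs"
  shows "signed_row (set vs) (path_edges vs) s x (vs ! k) =
    (if Suc k < length vs then s {vs ! k, vs ! Suc k} * x (vs ! Suc k) else 0) +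
    (if k > 0 then s {vs ! (k - 1), vs ! k} * x (vs ! (k - 1)) else 0)"
proof -
  have "signed_row (set vs) (path_edges vs) s x (vs ! k) =
      (\<Sum>m = 0..<length vs. (if m = Suc k then s {vs ! k, vs ! Suc k} * x (vs ! Suc k) else 0) +
        (if m = k - 1 then if k > 0 then s {vs ! (k - 1), vs ! k} * x (vs ! (k - 1)) else 0 else 0))"
    unfolding signed_row_def sum_nth_distinct[OF assms(1)]
    by (rule sum.cong)
      (use assms in \<open>auto simp: path_edges_nth_iff insert_commute\<close>)
  also have "\<dots> = (if Suc k < length vs then s {vs ! k, vs ! Suc k} * x (vs ! Suc k) else 0) +
      (if k > 0 then s {vs ! (k - 1), vs ! k} * x (vs ! (k - 1)) else 0)"
    unfolding sum.distrib using assms(2) by auto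
  finally show ?thesis .
qed

text \<open>In the coordinates \<open>y\<^sub>k = gauge\<^sub>k x\<^sub>k\<close> the kernel equation at an inner vertex
  of degree two reads \<open>y\<^sub>k\<^sub>+\<^sub>1 = y\<^sub>k\<^sub>-\<^sub>1\<close>, whatever the signs along the path.\<close>

primrec gauge :: "('a set \<Rightarrow> real) \<Rightarrow> 'a list \<Rightarrow> nat \<Rightarrow> real" where
  "gauge s vs 0 = 1"
| "gauge s vs (Suc k) = (-1) ^ k * s {vs ! k, vs ! Suc k} * gauge s vs k"

text \<open>All sets are quantified over, not just edges: sign values are 1 or -1 everywhere, and
  the gauge can then be handled without reference to a graph.\<close>

definition unit_weights :: "('a set \<Rightarrow> real) \<Rightarrow> bool" where
  "unit_weights s \<longleftrightarrow> (\<forall>e. s e * s e = 1)"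

lemma unit_weights_sign_val: "unit_weights (\<lambda>e. sign_val (f e))"
  unfolding unit_weights_def
proof
  fix e show "sign_val (f e) * sign_val (f e) = 1" by (cases "f e") auto
qed

lemma gauge_square:
  assumes "unit_weights s"
  shows "gauge s vs k * gauge s vs k = 1"
proof (induction k)
  case (Suc k)
  have "gauge s vs (Suc k) * gauge s vs (Suc k) =
      ((-1) ^ k * (-1) ^ k) * (s {vs ! k, vs ! Suc k} * s {vs ! k, vs ! Suc k}) *
      (gauge s vs k * gauge s vs k)"
    by (simp add: mult_ac)
  also have "\<dots> = 1"
    using Suc assms by (simp add: unit_weights_def flip: power_add)
  finally show ?case .
qed simp

lemma gauge_nonzero: "unit_weights s \<Longrightarrow> gauge s vs k \<noteq> 0"
  using gauge_square[of s vs k] by auto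

lemma gauge_cancel: "unit_weights s \<Longrightarrow> gauge s vs k * (gauge s vs k * c) = c"
  using gauge_square[of s vs k] by (simp flip: mult.assoc)

text \<open>Restarting the gauge at index \<open>j\<close> lowers every exponent in its recursion by
  \<open>j\<close>, which costs a factor \<open>(-1) ^ j\<close> in each of the \<open>k\<close>
  steps.\<close>

lemma gauge_drop:
  assumes "j + k < length vs"
  shows "gauge s vs (j + k) = (-1) ^ (j * k) * gauge s vs j * gauge s (drop j vs) k"
  using assms
proof (induction k)
  case (Suc k)
  then show ?case by (simp add: power_add mult_ac)
qed simp

lemma gauge_take:
  assumes "k < m"
  shows "gauge s (take m vs) k = gauge s vs k"
  using assms by (induction k) auto

text \<open>The edge to the successor contributes the factor \<open>(-1) ^ k\<close> and the edge to
  the predecessor \<open>(-1) ^ (k - 1)\<close>. The alternating factor in \<open>gauge\<close>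
  serves to give the two neighbours opposite signs.\<close>

lemma gauge_row_path:
  fixes x :: "'a \<Rightarrow> real"
  assumes s: "unit_weights s" and vs: "distinct vs" "k < length vs"
  defines "y \<equiv> \<lambda>m. gauge s vs m * x (vs ! m)"
  shows "gauge s vs k * signed_row (set vs) (path_edges vs) s x (vs ! k) =
    (-1) ^ k * ((if Suc k < length vs then y (Suc k) else 0) - (if k > 0 then y (k - 1) else 0))"
proof -
  have up: "gauge s vs k * (s {vs ! k, vs ! Suc k} * c) = (-1) ^ k * (gauge s vs (Suc k) * c)" for k c
  proof -
    have "(-1) ^ k * (gauge s vs (Suc k) * c) =
        ((-1) ^ k * (-1) ^ k) * (gauge s vs k * (s {vs ! k, vs ! Suc k} * c))"
      by (simp only: gauge.simps mult_ac)
    then show ?thesis by (simp flip: power_add)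
  qed
  have down: "gauge s vs (Suc k) * (s {vs ! k, vs ! Suc k} * c) = (-1) ^ k * (gauge s vs k * c)" for k c
  proof -
    have "gauge s vs (Suc k) * (s {vs ! k, vs ! Suc k} * c) =
        (s {vs ! k, vs ! Suc k} * s {vs ! k, vs ! Suc k}) * ((-1) ^ k * (gauge s vs k * c))"
      by (simp only: gauge.simps mult_ac)
    then show ?thesis using s by (simp add: unit_weights_def)
  qed
  show ?thesis
    unfolding signed_row_path[OF vs] y_def
    using up[of 0]
    by (cases k) (auto simp: up down distrib_left right_diff_distrib simp del: gauge.simps(2))
qed

text \<open>The weight \<open>w\<close> of a chord in gauge coordinates is symmetric in its ends, so
  the same number occurs in both affected equations.\<close>

lemma gauge_row_insert:
  fixes x :: "'a \<Rightarrow> real"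
  assumes s: "unit_weights s" and vs: "distinct vs" "k < length vs"
    and pq: "p < length vs" "q < length vs" "p \<noteq> q" "{vs ! p, vs ! q} \<notin> E"
  defines "y \<equiv> \<lambda>m. gauge s vs m * x (vs ! m)"
    and "w \<equiv> s {vs ! p, vs ! q} * gauge s vs p * gauge s vs q"
  shows "gauge s vs k * signed_row (set vs) (insert {vs ! p, vs ! q} E) s x (vs ! k) =
    gauge s vs k * signed_row (set vs) E s x (vs ! k) +
    (if k = p then w * y q else 0) + (if k = q then w * y p else 0)"
proof -
  have "w * y q = s {vs ! p, vs ! q} * gauge s vs p * x (vs ! q)"
    "w * y p = s {vs ! p, vs ! q} * gauge s vs q * x (vs ! p)"
    unfolding w_def y_def using gauge_cancel[OF s, of vs] by (simp_all add: mult.assoc mult.left_commute)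
  moreover have "vs ! k = vs ! p \<longleftrightarrow> k = p" "vs ! k = vs ! q \<longleftrightarrow> k = q" "vs ! p \<noteq> vs ! q"
    using vs pq by (auto simp: nth_eq_iff_index_eq)
  ultimately show ?thesis
    using pq by (subst signed_row_insert) (auto simp: algebra_simps)
qed

lemma in_kernel_gauge_iff:
  assumes "verts \<Gamma> = set vs"
  shows "in_kernel \<Gamma> x \<longleftrightarrow> (\<forall>k<length vs. gauge (\<lambda>e. sign_val (edge_sign \<Gamma> e)) vs k *
    signed_row (set vs) (edges \<Gamma>) (\<lambda>e. sign_val (edge_sign \<Gamma> e)) x (vs ! k) = 0)"
  unfolding in_kernel_def assms
  by (simp add: gauge_nonzero[OF unit_weights_sign_val] all_set_conv_all_nth)

lemma ex_gauge_coordinates: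
  assumes s: "unit_weights s" and vs: "distinct vs"
  obtains x where "\<And>k. k < length vs \<Longrightarrow> gauge s vs k * x (vs ! k) = y k"
proof
  fix k assume k: "k < length vs"
  define r where "r = inv_into {..<length vs} ((!) vs)"
  have "r (vs ! k) = k"
    unfolding r_def using vs k by (intro inv_into_f_f inj_on_nth) auto
  then show "gauge s vs k * (\<lambda>v. gauge s vs (inv_into {..<length vs} ((!) vs) v) *
      y (inv_into {..<length vs} ((!) vs) v)) (vs ! k) = y k"
    using gauge_cancel[OF s] by (simp add: r_def)
qed

text \<open>Gauge factors are nonzero, so passing to gauge coordinates is an invertible diagonal
  change of variables, and prescribing values at vertices amounts to prescribing the sequence on
  \<open>I\<close>. The assumption \<open>cong\<close> makes \<open>R\<close> depend only on indices
  of vertices.\<close>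

lemma nullity_eq_card_iff_gauge:
  fixes \<Gamma> :: "'a signed_graph"
  defines "s \<equiv> \<lambda>e. sign_val (edge_sign \<Gamma> e)"
  assumes vs: "distinct vs" "verts \<Gamma> = set vs" and I: "\<And>i. i \<in> I \<Longrightarrow> i < length vs"
    and R: "\<And>x. in_kernel \<Gamma> x \<longleftrightarrow> R (\<lambda>k. gauge s vs k * x (vs ! k))"
    and cong: "\<And>y z. (\<And>k. k < length vs \<Longrightarrow> y k = z k) \<Longrightarrow> R y \<Longrightarrow> R z"
    and det: "\<And>y k. R y \<Longrightarrow> (\<And>i. i \<in> I \<Longrightarrow> y i = 0) \<Longrightarrow> k < length vs \<Longrightarrow> y k = 0"
  shows "nullity \<Gamma> = card I \<longleftrightarrow> (\<forall>c. \<exists>y. R y \<and> (\<forall>i\<in>I. y i = c i))"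
proof -
  note s = unit_weights_sign_val[of "edge_sign \<Gamma>", folded s_def]
  let ?S = "(!) vs ` I"
  have inj: "inj_on ((!) vs) I" using I vs by (intro inj_on_nth) auto
  have "kernel_determined \<Gamma> ?S"
    unfolding kernel_determined_def vs(2)
  proof (intro allI impI ballI)
    fix x v assume x: "in_kernel \<Gamma> x" "\<forall>v\<in>?S. x v = 0" and "v \<in> set vs"
    then obtain k where k: "k < length vs" "v = vs ! k" by (auto simp: in_set_conv_nth)
    have "gauge s vs k * x (vs ! k) = 0"
      using det[of "\<lambda>k. gauge s vs k * x (vs ! k)" k] x R k by auto
    then show "x v = 0" using gauge_nonzero[OF s] k by simp
  qed
  then have "nullity \<Gamma> = card ?S \<longleftrightarrow> (\<forall>c. \<exists>x. in_kernel \<Gamma> x \<and> (\<forall>v\<in>?S. x v = c v))"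
    using vs I by (intro nullity_eq_card_iff) auto
  also have "card ?S = card I" by (rule card_image[OF inj])
  also have "(\<forall>c. \<exists>x. in_kernel \<Gamma> x \<and> (\<forall>v\<in>?S. x v = c v)) \<longleftrightarrow> (\<forall>c. \<exists>y. R y \<and> (\<forall>i\<in>I. y i = c i))"
  proof (intro iffI allI)
    fix c assume *: "\<forall>c. \<exists>x. in_kernel \<Gamma> x \<and> (\<forall>v\<in>?S. x v = c v)"
    obtain d where d: "\<And>k. k < length vs \<Longrightarrow> gauge s vs k * d (vs ! k) = c k"
      using ex_gauge_coordinates[OF s vs(1), where y = c] by blast
    obtain x where x: "in_kernel \<Gamma> x" "\<forall>v\<in>?S. x v = d v" using * by blast
    then show "\<exists>y. R y \<and> (\<forall>i\<in>I. y i = c i)"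
      using R d I by (intro exI[of _ "\<lambda>k. gauge s vs k * x (vs ! k)"]) auto
  next
    fix c assume *: "\<forall>c. \<exists>y. R y \<and> (\<forall>i\<in>I. y i = c i)"
    obtain y where y: "R y" "\<forall>i\<in>I. y i = gauge s vs i * c (vs ! i)"
      using *[rule_format, of "\<lambda>i. gauge s vs i * c (vs ! i)"] by blast
    obtain x where x: "\<And>k. k < length vs \<Longrightarrow> gauge s vs k * x (vs ! k) = y k"
      using ex_gauge_coordinates[OF s vs(1), where y = y] by blast
    have "in_kernel \<Gamma> x" unfolding R by (rule cong[OF _ y(1)]) (simp add: x)
    moreover have "x (vs ! i) = c (vs ! i)" if "i \<in> I" for i
      using x[OF I[OF that]] y(2) that gauge_nonzero[OF s, of vs i] by simp
    ultimately show "\<exists>x. in_kernel \<Gamma> x \<and> (\<forall>v\<in>?S. x v = c v)" by auto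
  qed
  finally show ?thesis .
qed

section \<open>Alternating sequences and cycles of nullity two\<close>

lemma alternating_sequence:
  fixes y :: "nat \<Rightarrow> real"
  assumes "\<And>k. 0 < k \<Longrightarrow> k < m \<Longrightarrow> y (Suc k) = y (k - 1)" "k \<le> m"
  shows "y k = (if even k then y 0 else y 1)"
  using assms(2)
proof (induction k rule: less_induct)
  case (less k)
  show ?case
  proof (cases "k < 2")
    case True
    then show ?thesis by (cases k) auto
  next
    case False
    then obtain l where l: "k = Suc (Suc l)" by (metis add_2_eq_Suc le_Suc_ex not_less)
    then have "y k = y l" using assms(1)[of "Suc l"] less.prems by simp
    then show ?thesis using less.IH[of l] l less.prems by simp
  qed
qed

text \<open>Inner equations make the sequence alternate, so \<open>y 0\<close> and
  \<open>y 1\<close> determine it, and nullity 2 means that both are free. Here \<open>m\<close> is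
  the last index, hence odd \<open>m\<close> means even length. Expanding the gauge, the condition
  describes the positive cycles of length 0 modulo 4 and the negative ones of length 2 modulo
  4.\<close>

lemma nullity_signed_cycle_iff:
  fixes \<Gamma> :: "'a signed_graph"
  assumes c: "distinct c" "3 \<le> length c"
  defines "s \<equiv> \<lambda>e. sign_val (edge_sign \<Gamma> e)" and "m \<equiv> length c - 1"
  shows "nullity (signed_cycle \<Gamma> c) = 2 \<longleftrightarrow> odd m \<and> s {c ! m, c ! 0} * gauge s c m = -1"
proof -
  note s = unit_weights_sign_val[of "edge_sign \<Gamma>", folded s_def]
  define A where "A = s {c ! m, c ! 0} * gauge s c m * gauge s c 0"
  have m: "2 \<le> m" "length c = Suc m" using c by (auto simp: m_def)
  define R where "R y \<longleftrightarrow> (\<forall>k\<le>m. (-1) ^ k * ((if k < m then y (Suc k) else 0) - (if k > 0 then y (k - 1) else 0))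
      + (if k = m then A * y 0 else 0) + (if k = 0 then A * y m else 0) = 0)" for y :: "nat \<Rightarrow> real"
  have "c \<noteq> []" using c by auto
  then have ce: "cycle_edges c = insert {c ! m, c ! 0} (path_edges c)"
    by (simp add: cycle_edges_def last_conv_nth hd_conv_nth m_def)
  have notin: "{c ! m, c ! 0} \<notin> path_edges c"
    using path_edges_nth_iff[of c m 0] c m by auto
  have rows: "in_kernel (signed_cycle \<Gamma> c) x \<longleftrightarrow> R (\<lambda>k. gauge s c k * x (c ! k))" for x
  proof -
    have "in_kernel (signed_cycle \<Gamma> c) x \<longleftrightarrow>
        (\<forall>k<length c. gauge s c k * signed_row (set c) (cycle_edges c) s x (c ! k) = 0)"
      using in_kernel_gauge_iff[of "signed_cycle \<Gamma> c" c x] by (simp add: signed_cycle_def s_def)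
    also have "\<dots> \<longleftrightarrow> R (\<lambda>k. gauge s c k * x (c ! k))"
    proof -
      have mc: "m < length c" "0 < length c" "m \<noteq> 0" using m by auto
      show ?thesis
        unfolding R_def ce less_Suc_eq_le[symmetric] m(2)[symmetric]
        by (intro all_cong1 imp_cong refl)
          (simp only: gauge_row_insert[OF s c(1) _ mc notin] gauge_row_path[OF s c(1)] A_def m(2)
            Suc_less_eq)
    qed
    finally show ?thesis .
  qed
  have alt: "y k = (if even k then y 0 else y 1)" if "R y" "k \<le> m" for y k
  proof (rule alternating_sequence[OF _ that(2)])
    fix k assume "0 < k" "k < m"
    then show "y (Suc k) = y (k - 1)" using that(1)[unfolded R_def, rule_format, of k] by simp
  qed
  have "nullity (signed_cycle \<Gamma> c) = card {0::nat, 1} \<longleftrightarrow> (\<forall>d. \<exists>y. R y \<and> (\<forall>i\<in>{0, 1}. y i = d i))"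
  proof (rule nullity_eq_card_iff_gauge[of c])
    show "distinct c" "verts (signed_cycle \<Gamma> c) = set c" by (use c in \<open>simp_all add: signed_cycle_def\<close>)
    show "in_kernel (signed_cycle \<Gamma> c) x \<longleftrightarrow>
        R (\<lambda>k. gauge (\<lambda>e. sign_val (edge_sign (signed_cycle \<Gamma> c) e)) c k * x (c ! k))" for x
      using rows by (simp add: signed_cycle_def s_def)
    show "i < length c" if "i \<in> {0, 1}" for i using that m by auto
    show "R z" if "\<And>k. k < length c \<Longrightarrow> y k = z k" "R y" for y z
      using that m unfolding R_def by (auto simp: less_Suc_eq_le)
    show "y k = 0" if "R y" "\<And>i. i \<in> {0, 1} \<Longrightarrow> y i = 0" "k < length c" for y k
      using alt[OF that(1), of k] that(2)[of 0] that(2)[of 1] that(3) m by simp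
  qed
  also have "(\<forall>d. \<exists>y. R y \<and> (\<forall>i\<in>{0, 1}. y i = d i)) \<longleftrightarrow> odd m \<and> A = -1"
  proof
    assume "\<forall>d. \<exists>y. R y \<and> (\<forall>i\<in>{0, 1}. y i = d i)"
    \<comment> \<open>With \<open>y 0 = 0\<close> and \<open>y 1 = 1\<close> the equation at index 0
      forces \<open>y m\<close> to be nonzero; alternation then gives odd \<open>m\<close> and
      \<open>y m = 1\<close>.\<close>
    from this[rule_format, of "\<lambda>i. if i = 0 then 0 else 1"]
    obtain y where y: "R y" "y 0 = 0" "y 1 = 1" by auto
    have "y 1 + A * y m = 0" using y(1)[unfolded R_def, rule_format, of 0] m by simp
    then show "odd m \<and> A = -1" using alt[OF y(1), of m] y by (auto split: if_splits)
  next
    assume mA: "odd m \<and> A = -1"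
    show "\<forall>d. \<exists>y. R y \<and> (\<forall>i\<in>{0, 1}. y i = d i)"
    proof
      fix d :: "nat \<Rightarrow> real"
      have "R (\<lambda>k. if even k then d 0 else d 1)"
        unfolding R_def using mA m by auto
      then show "\<exists>y. R y \<and> (\<forall>i\<in>{0, 1}. y i = d i)"
        by (intro exI[of _ "\<lambda>k. if even k then d 0 else d 1"]) auto
    qed
  qed
  finally show ?thesis by (simp add: A_def numeral_2_eq_2)
qed

section \<open>Hamiltonian paths with two closing chords\<close>

definition closed_path_form :: "('a, 'm) graph_scheme \<Rightarrow> 'a list \<Rightarrow> nat \<Rightarrow> nat \<Rightarrow> bool" where
  "closed_path_form G vs i j \<longleftrightarrow> distinct vs \<and> verts G = set vs \<and>
     2 \<le> i \<and> i < length vs \<and> j + 2 < length vs \<and> \<not> (Suc i = length vs \<and> j = 0) \<and>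
     edges G = insert {vs ! 0, vs ! i} (insert {vs ! (length vs - 1), vs ! j} (path_edges vs))"

text \<open>The inequalities of \<open>closed_path_form\<close> keep both chords off the path, and
  its negated conjunct keeps them from coinciding. Hence the chords can be inserted one after the
  other, in kernel equations as in edge counts.\<close>

lemma closed_path_form_chords:
  assumes "distinct vs" "2 \<le> i" "i < length vs" "j + 2 < length vs"
    "\<not> (Suc i = length vs \<and> j = 0)"
  shows "{vs ! (length vs - 1), vs ! j} \<notin> path_edges vs"
    "{vs ! 0, vs ! i} \<notin> insert {vs ! (length vs - 1), vs ! j} (path_edges vs)"
proof -
  have l: "length vs - 1 < length vs" "j < length vs" "0 < length vs" using assms by linarith+
  show "{vs ! (length vs - 1), vs ! j} \<notin> path_edges vs"
    using path_edges_nth_iff[OF assms(1) l(1,2)] assms(4) by linarith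
  have "{vs ! 0, vs ! i} \<notin> path_edges vs"
    using path_edges_nth_iff[OF assms(1) l(3) assms(3)] assms(2) by linarith
  moreover have "{vs ! 0, vs ! i} \<noteq> {vs ! (length vs - 1), vs ! j}"
    using assms l by (auto simp: doubleton_eq_iff nth_eq_iff_index_eq)
  ultimately show "{vs ! 0, vs ! i} \<notin> insert {vs ! (length vs - 1), vs ! j} (path_edges vs)"
    by simp
qed

text \<open>The values at 0, 1 and \<open>n\<close> determine a kernel vector, so nullity 3 means
  that they can be prescribed freely. The prescription 0, 1, 0 alone yields all the conditions;
  under them an explicit solution exists for every prescription.\<close>

lemma nullity_closed_path_form_iff:
  assumes form: "closed_path_form \<Gamma> vs i j"
  defines "s \<equiv> \<lambda>e. sign_val (edge_sign \<Gamma> e)" and "n \<equiv> length vs - 1"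
  shows "nullity \<Gamma> = 3 \<longleftrightarrow> even n \<and> odd i \<and> odd j \<and>
    s {vs ! 0, vs ! i} * gauge s vs i = -1 \<and>
    s {vs ! n, vs ! j} * gauge s vs n * gauge s vs j = 1"
proof -
  note s = unit_weights_sign_val[of "edge_sign \<Gamma>", folded s_def]
  have vs: "distinct vs" "verts \<Gamma> = set vs" and ij: "2 \<le> i" "i \<le> n" "j + 2 \<le> n" "\<not> (i = n \<and> j = 0)"
    and len: "length vs = Suc n"
    and E: "edges \<Gamma> = insert {vs ! 0, vs ! i} (insert {vs ! n, vs ! j} (path_edges vs))"
    using form by (auto simp: closed_path_form_def n_def)
  have notin: "{vs ! n, vs ! j} \<notin> path_edges vs"
    "{vs ! 0, vs ! i} \<notin> insert {vs ! n, vs ! j} (path_edges vs)"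
    using closed_path_form_chords[of vs i j] form by (auto simp: closed_path_form_def n_def)
  define A where "A = s {vs ! 0, vs ! i} * gauge s vs 0 * gauge s vs i"
  define B where "B = s {vs ! n, vs ! j} * gauge s vs n * gauge s vs j"
  define R where "R y \<longleftrightarrow> (\<forall>k\<le>n. (-1) ^ k * ((if k < n then y (Suc k) else 0) - (if k > 0 then y (k - 1) else 0))
      + (if k = n then B * y j else 0) + (if k = j then B * y n else 0)
      + (if k = 0 then A * y i else 0) + (if k = i then A * y 0 else 0) = 0)" for y :: "nat \<Rightarrow> real"
  have rows: "in_kernel \<Gamma> x \<longleftrightarrow> R (\<lambda>k. gauge s vs k * x (vs ! k))" for x
  proof -
    have "in_kernel \<Gamma> x \<longleftrightarrow>
        (\<forall>k<length vs. gauge s vs k * signed_row (set vs) (edges \<Gamma>) s x (vs ! k) = 0)"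
      using in_kernel_gauge_iff[OF vs(2)] by (simp add: s_def)
    also have "\<dots> \<longleftrightarrow> R (\<lambda>k. gauge s vs k * x (vs ! k))"
    proof -
      have nj: "n < length vs" "j < length vs" "n \<noteq> j"
        and oi: "0 < length vs" "i < length vs" "0 \<noteq> i" using ij len by auto
      show ?thesis
        unfolding R_def E less_Suc_eq_le[symmetric] len[symmetric]
        by (intro all_cong1 imp_cong refl)
          (simp only: gauge_row_insert[OF s vs(1) _ nj notin(1)] gauge_row_insert[OF s vs(1) _ oi notin(2)]
            gauge_row_path[OF s vs(1)] A_def B_def len Suc_less_eq)
    qed
    finally show ?thesis .
  qed
  \<comment> \<open>Once \<open>y 0\<close> and \<open>y n\<close> vanish, the chords contribute
    nothing at inner indices, not even at \<open>i\<close> and \<open>j\<close>, so the sequence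
    alternates along the whole path.\<close>
  have alt: "y k = (if even k then y 0 else y 1)" if "R y" "y 0 = 0" "y n = 0" "k \<le> n" for y k
  proof (rule alternating_sequence[OF _ that(4)])
    fix k assume "0 < k" "k < n"
    then show "y (Suc k) = y (k - 1)"
      using that(1)[unfolded R_def, rule_format, of k] that(2,3) by (simp split: if_splits)
  qed
  have "nullity \<Gamma> = card {0, 1, n} \<longleftrightarrow> (\<forall>d. \<exists>y. R y \<and> (\<forall>i\<in>{0, 1, n}. y i = d i))"
  proof (rule nullity_eq_card_iff_gauge[OF vs])
    show "in_kernel \<Gamma> x \<longleftrightarrow> R (\<lambda>k. gauge (\<lambda>e. sign_val (edge_sign \<Gamma> e)) vs k * x (vs ! k))" for x
      using rows by (simp add: s_def)
    show "i < length vs" if "i \<in> {0, 1, n}" for i using that ij len by auto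
    show "R z" if "\<And>k. k < length vs \<Longrightarrow> y k = z k" "R y" for y z
    proof -
      have eq: "y k = z k" if "k \<le> n" for k
        using \<open>\<And>k. k < length vs \<Longrightarrow> y k = z k\<close> that len by simp
      have eq_step: "(if k < n then y (Suc k) else 0) = (if k < n then z (Suc k) else 0)"
        "y (k - 1) = z (k - 1)" if "k \<le> n" for k
        using eq[of "Suc k"] eq[of "k - 1"] that by auto
      have eq_ij: "y i = z i" "y j = z j" "y 0 = z 0" "y n = z n" using eq ij by auto
      show ?thesis
        unfolding R_def
      proof (intro allI impI)
        fix k assume k: "k \<le> n"
        show "(-1) ^ k * ((if k < n then z (Suc k) else 0) - (if k > 0 then z (k - 1) else 0))
          + (if k = n then B * z j else 0) + (if k = j then B * z n else 0)
          + (if k = 0 then A * z i else 0) + (if k = i then A * z 0 else 0) = 0"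
          using that(2)[unfolded R_def, rule_format, OF k] unfolding eq_step[OF k] eq_ij .
      qed
    qed
    show "y k = 0" if "R y" "\<And>i. i \<in> {0, 1, n} \<Longrightarrow> y i = 0" "k < length vs" for y k
      using alt[OF that(1), of k] that(2)[of 0] that(2)[of 1] that(2)[of n] that(3) len by simp
  qed
  also have "card {0, 1, n} = 3" using ij by simp
  also have "(\<forall>d. \<exists>y. R y \<and> (\<forall>i\<in>{0, 1, n}. y i = d i)) \<longleftrightarrow>
      even n \<and> odd i \<and> odd j \<and> A = -1 \<and> B = 1"
  proof
    assume "\<forall>d. \<exists>y. R y \<and> (\<forall>i\<in>{0, 1, n}. y i = d i)"
    \<comment> \<open>For this vector alternation with \<open>y n = 0\<close> gives the parity of
      \<open>n\<close>; the equation at 0 gives \<open>i\<close> and \<open>A\<close>, and the one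
      at \<open>n\<close> gives \<open>j\<close> and \<open>B\<close>.\<close>
    from this[rule_format, of "\<lambda>i. if i = 1 then 1 else 0"]
    obtain y where y: "R y" "y 0 = 0" "y 1 = 1" "y n = 0" using ij by auto
    note alt' = alt[OF y(1,2,4)]
    have n: "even n" using alt'[of n] y by (auto split: if_splits)
    have "y 1 + A * y i = 0" using y(1)[unfolded R_def, rule_format, of 0] ij y by (simp split: if_splits)
    then have i: "odd i" "A = -1" using alt'[of i] ij y by (auto split: if_splits)
    have "- y (n - 1) + B * y j = 0"
      using y(1)[unfolded R_def, rule_format, of n] ij y n by (auto split: if_splits)
    moreover have "y (n - 1) = 1" using alt'[of "n - 1"] n ij y by simp
    ultimately have "odd j" "B = 1" using alt'[of j] ij y by (auto split: if_splits)
    with n i show "even n \<and> odd i \<and> odd j \<and> A = -1 \<and> B = 1" by blast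
  next
    assume *: "even n \<and> odd i \<and> odd j \<and> A = -1 \<and> B = 1"
    show "\<forall>d. \<exists>y. R y \<and> (\<forall>i\<in>{0, 1, n}. y i = d i)"
    proof
      fix d :: "nat \<Rightarrow> real"
      \<comment> \<open>Odd entries are constant. The even entries drop by \<open>d 0\<close> across
        \<open>i\<close> and rise by \<open>d n\<close> across \<open>j\<close>, which is what the
        chord terms in the equations at \<open>i\<close> and \<open>j\<close> require.\<close>
      define y where "y k = (if odd k then d 1 else (if k < i then d 0 else 0) + (if j < k then d n else 0))" for k
      have i: "i < n" using * ij by (metis le_neq_implies_less)
      have "R y"
        unfolding R_def
      proof (intro allI impI)
        fix k assume k: "k \<le> n"
        show "(-1) ^ k * ((if k < n then y (Suc k) else 0) - (if k > 0 then y (k - 1) else 0))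
          + (if k = n then B * y j else 0) + (if k = j then B * y n else 0)
          + (if k = 0 then A * y i else 0) + (if k = i then A * y 0 else 0) = 0"
        proof (cases "even k")
          case True
          then have "y (k - 1) = d 1" if "0 < k" using that by (simp add: y_def)
          moreover have "y (Suc k) = d 1" "y i = d 1" "y j = d 1" "k \<noteq> i" "k \<noteq> j"
            using True * by (auto simp: y_def)
          ultimately show ?thesis using True * k i ij by auto
        next
          case False
          \<comment> \<open>All three indices are odd, so comparing the even indices
            \<open>k - 1\<close> and \<open>Suc k\<close> with \<open>i\<close> and \<open>j\<close>
            reduces to comparing \<open>a\<close> with \<open>b\<close> and
            \<open>c\<close>.\<close>
          obtain a b c where abc: "k = Suc (2 * a)" "i = Suc (2 * b)" "j = Suc (2 * c)"
            using False * by (metis oddE Suc_eq_plus1)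
          have "k < n" using k False * by (metis le_neq_implies_less)
          moreover have "y (Suc k) = (if a < b then d 0 else 0) + (if c \<le> a then d n else 0)"
            "y (k - 1) = (if a \<le> b then d 0 else 0) + (if c < a then d n else 0)"
            using abc by (auto simp: y_def)
          moreover have "y 0 = d 0" "y n = d n" using * i ij by (auto simp: y_def)
          ultimately show ?thesis using False * ij by (auto simp: abc)
        qed
      qed
      moreover have "\<forall>i\<in>{0, 1, n}. y i = d i"
        using * ij i by (auto simp: y_def)
      ultimately show "\<exists>y. R y \<and> (\<forall>i\<in>{0, 1, n}. y i = d i)" by blast
    qed
  qed
  finally show ?thesis by (simp add: A_def B_def)
qed

text \<open>The cycle \<open>drop j vs\<close> has a gauge of its own, starting at \<open>j\<close>.
  By \<open>gauge_drop\<close> the change of starting point costs the sign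
  \<open>(-1) ^ (j * (n - j))\<close>, which is -1 for odd \<open>j\<close> and \<open>n - j\<close>
  and turns the value 1 for the second chord into the cycle condition -1.\<close>

lemma nullity_closed_path_form:
  assumes form: "closed_path_form \<Gamma> vs i j"
  shows "nullity \<Gamma> = 3 \<longleftrightarrow> even (i + j) \<and>
    nullity (signed_cycle \<Gamma> (take (Suc i) vs)) = 2 \<and> nullity (signed_cycle \<Gamma> (drop j vs)) = 2"
proof -
  define s where "s = (\<lambda>e. sign_val (edge_sign \<Gamma> e))"
  define n where "n = length vs - 1"
  have vs: "distinct vs" and ij: "2 \<le> i" "i \<le> n" "j + 2 \<le> n" and len: "length vs = Suc n"
    using form by (auto simp: closed_path_form_def n_def)
  have c1: "nullity (signed_cycle \<Gamma> (take (Suc i) vs)) = 2 \<longleftrightarrow>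
      odd i \<and> s {vs ! 0, vs ! i} * gauge s vs i = -1"
  proof -
    have l: "length (take (Suc i) vs) = Suc i" using ij len by simp
    show ?thesis
      using nullity_signed_cycle_iff[of "take (Suc i) vs" \<Gamma>] vs ij unfolding l
      by (simp add: s_def gauge_take insert_commute)
  qed
  have c2: "nullity (signed_cycle \<Gamma> (drop j vs)) = 2 \<longleftrightarrow>
      odd (n - j) \<and> s {vs ! n, vs ! j} * gauge s (drop j vs) (n - j) = -1"
    using nullity_signed_cycle_iff[of "drop j vs" \<Gamma>] vs ij len
    by (simp add: s_def)
  have g: "gauge s vs n * gauge s vs j = - gauge s (drop j vs) (n - j)" if "odd j" "odd (n - j)"
  proof -
    have "gauge s vs n = - (gauge s vs j * gauge s (drop j vs) (n - j))"
      using gauge_drop[of j "n - j" vs s] that ij len by simp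
    then show ?thesis
      using gauge_square[OF unit_weights_sign_val, of "edge_sign \<Gamma>" vs j]
      by (simp add: s_def mult_ac)
  qed
  show ?thesis
    unfolding nullity_closed_path_form_iff[OF form, folded s_def n_def] c1 c2
    using g ij by (cases "odd j"; cases "odd (n - j)") (auto simp: mult.assoc s_def[THEN fun_cong, symmetric])
qed

section \<open>Structure of leaf-free bicyclic graphs\<close>

lemma finite_edges: "simple_graph G \<Longrightarrow> finite (edges G)"
  unfolding simple_graph_def by (rule finite_subset[of _ "Pow (verts G)"]) fastforce+

lemma sum_degree_of:
  assumes "simple_graph G"
  shows "(\<Sum>v\<in>verts G. degree_of G v) = 2 * card (edges G)"
proof -
  have fin: "finite (verts G)" using assms by (simp add: simple_graph_def)
  have "(\<Sum>v\<in>verts G. degree_of G v) = (\<Sum>e\<in>edges G. card {v \<in> verts G. v \<in> e})"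
    unfolding degree_of_def card_eq_sum
    by (rule sum.swap_restrict[OF fin finite_edges[OF assms]])
  also have "\<dots> = (\<Sum>e\<in>edges G. 2)"
  proof (rule sum.cong[OF refl])
    fix e assume "e \<in> edges G"
    then obtain u v where "u \<in> verts G" "v \<in> verts G" "u \<noteq> v" "e = {u, v}"
      using assms unfolding simple_graph_def by blast
    then have "{v \<in> verts G. v \<in> e} = {u, v}" by auto
    then show "card {v \<in> verts G. v \<in> e} = 2" using \<open>u \<noteq> v\<close> by simp
  qed
  finally show ?thesis by simp
qed

lemma connected_closed_set:
  assumes "connected_graph G" "U \<subseteq> verts G" "U \<noteq> {}"
    and "\<And>u w. u \<in> U \<Longrightarrow> {u, w} \<in> edges G \<Longrightarrow> w \<in> U"
  shows "U = verts G"
proof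
  obtain u where u: "u \<in> U" using assms by blast
  show "verts G \<subseteq> U"
  proof
    fix v assume "v \<in> verts G"
    then have "(u, v) \<in> {(u, v). {u, v} \<in> edges G}\<^sup>*"
      using assms u unfolding connected_graph_def conn_rel_def by blast
    then show "v \<in> U" by (induction rule: rtrancl_induct) (use u assms(4) in auto)
  qed
qed (use assms in blast)

text \<open>Both degree sums exceed twice the number of vertices by two, so no vertex of \<open>H\<close>
  can have an additional edge in \<open>G\<close>.\<close>

lemma bicyclic_subgraph_eq:
  fixes G :: "('a, 'm) graph_scheme" and H :: "('a, 'n) graph_scheme"
  assumes G: "simple_graph G" "bicyclic G" "\<And>v. v \<in> verts G \<Longrightarrow> 2 \<le> degree_of G v"
    and H: "simple_graph H" "verts H \<subseteq> verts G" "edges H \<subseteq> edges G" "verts H \<noteq> {}"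
      "card (edges H) = card (verts H) + 1"
  shows "verts H = verts G" "edges H = edges G"
proof -
  have fin: "finite (verts G)" using G by (simp add: simple_graph_def)
  have finE: "finite (edges G)" using finite_edges[OF G(1)] .
  have le: "degree_of H v \<le> degree_of G v" for v
    unfolding degree_of_def using finE H(3) by (intro card_mono) auto
  have "(\<Sum>v\<in>verts G. degree_of G v) =
      (\<Sum>v\<in>verts G - verts H. degree_of G v) + (\<Sum>v\<in>verts H. degree_of G v)"
    by (rule sum.subset_diff[OF H(2) fin])
  moreover have "(\<Sum>v\<in>verts G - verts H. degree_of G v) \<ge> (\<Sum>v\<in>verts G - verts H. 2)"
    by (rule sum_mono) (use G(3) in auto)
  moreover have "card (verts G - verts H) = card (verts G) - card (verts H)"
    "card (verts H) \<le> card (verts G)"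
    using H(2) fin by (auto simp: card_Diff_subset finite_subset card_mono)
  \<comment> \<open>The total degree in \<open>G\<close> is \<open>2 * card (verts G) + 2\<close>,
    and every vertex outside \<open>H\<close> takes at least 2 of it. This leaves at most
    \<open>2 * card (verts H) + 2\<close>, the total degree in \<open>H\<close>.\<close>
  ultimately have "(\<Sum>v\<in>verts H. degree_of G v) \<le> (\<Sum>v\<in>verts H. degree_of H v)"
    using sum_degree_of[OF G(1)] sum_degree_of[OF H(1)] G(2) H(5) by (simp add: bicyclic_def)
  moreover have "(\<Sum>v\<in>verts H. degree_of H v) < (\<Sum>v\<in>verts H. degree_of G v)"
    if "v \<in> verts H" "degree_of H v \<noteq> degree_of G v" for v
  proof (rule sum_strict_mono_ex1)
    show "finite (verts H)" using fin H(2) by (rule rev_finite_subset)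
    show "\<exists>v\<in>verts H. degree_of H v < degree_of G v"
      using that le[of v] by (intro bexI[of _ v]) auto
  qed (use le in blast)
  ultimately have eq: "degree_of H v = degree_of G v" if "v \<in> verts H" for v
    using that by (meson not_le)
  have inc: "e \<in> edges H" if "v \<in> verts H" "v \<in> e" "e \<in> edges G" for v e
  proof -
    have "{e \<in> edges H. v \<in> e} = {e \<in> edges G. v \<in> e}"
      using eq[OF that(1)] finE H(3) unfolding degree_of_def by (intro card_subset_eq) auto
    then show ?thesis using that by blast
  qed
  have Hv: "e \<subseteq> verts H" if "e \<in> edges H" for e
    using H(1) that unfolding simple_graph_def by fastforce
  show V: "verts H = verts G"
  proof (rule connected_closed_set)
    show "connected_graph G" using G(2) by (simp add: bicyclic_def)
    show "w \<in> verts H" if "u \<in> verts H" "{u, w} \<in> edges G" for u w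
      using inc[OF that(1) _ that(2)] Hv by blast
  qed (use H in auto)
  show "edges H = edges G"
  proof
    show "edges G \<subseteq> edges H"
    proof
      fix e assume e: "e \<in> edges G"
      then obtain u v where "u \<in> verts G" "e = {u, v}"
        using G(1) unfolding simple_graph_def by blast
      then show "e \<in> edges H" using inc[of u e] e V by simp
    qed
  qed (rule H(3))
qed

text \<open>A vertex of degree 0 would be the whole connected graph, which then has no
  edges.\<close>

lemma min_degree_bicyclic:
  assumes "simple_graph G" "leaf_free G" "bicyclic G" "v \<in> verts G"
  shows "2 \<le> degree_of G v"
proof (rule ccontr)
  assume "\<not> 2 \<le> degree_of G v"
  then have "degree_of G v = 0"
    using assms by (auto simp: leaf_free_def dest!: bspec[of _ _ v])
  then have no: "v \<notin> e" if "e \<in> edges G" for e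
    using that finite_edges[OF assms(1)] by (auto simp: degree_of_def)
  have V: "{v} = verts G"
  proof (rule connected_closed_set)
    show "connected_graph G" using assms by (simp add: bicyclic_def)
    show "w \<in> {v}" if "u \<in> {v}" "{u, w} \<in> edges G" for u w
      using no[OF that(2)] that(1) by blast
  qed (use assms in auto)
  have "edges G = {}"
    using assms(1) no unfolding simple_graph_def V[symmetric] by fastforce
  then show False using assms(3) by (simp add: bicyclic_def)
qed

lemma ex_other_neighbour:
  assumes "simple_graph G" "2 \<le> degree_of G v"
  obtains w where "w \<in> verts G" "w \<noteq> v" "w \<noteq> u" "{v, w} \<in> edges G"
proof -
  have "\<not> {e \<in> edges G. v \<in> e} \<subseteq> {{v, u}}"
  proof
    assume "{e \<in> edges G. v \<in> e} \<subseteq> {{v, u}}"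
    then have "degree_of G v \<le> card {{v, u}}"
      unfolding degree_of_def by (intro card_mono) auto
    then show False using assms(2) by simp
  qed
  then obtain e where e: "e \<in> edges G" "v \<in> e" "e \<noteq> {v, u}" by blast
  then obtain a b where "a \<in> verts G" "b \<in> verts G" "a \<noteq> b" "e = {a, b}"
    using assms(1) unfolding simple_graph_def by blast
  with e that[of a] that[of b] show thesis by (auto simp: insert_commute)
qed

section \<open>Edge sets of paths and cycles given by lists\<close>

lemma path_edges_conv_image: "path_edges xs = (\<lambda>i. {xs ! i, xs ! Suc i}) ` {..<length xs - 1}"
  by (auto simp: path_edges_def)

lemma path_edges_single [simp]: "path_edges [a] = {}"
  by (simp add: path_edges_def)

lemma path_edges_Cons: "xs \<noteq> [] \<Longrightarrow> path_edges (x # xs) = insert {x, hd xs} (path_edges xs)"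
proof -
  assume "xs \<noteq> []"
  then have "{..<length (x # xs) - 1} = insert 0 (Suc ` {..<length xs - 1})"
    by (cases xs) (auto simp: lessThan_Suc_eq_insert_0)
  then show ?thesis
    using \<open>xs \<noteq> []\<close> unfolding path_edges_conv_image by (simp add: image_image hd_conv_nth)
qed

lemma path_edges_append:
  "xs \<noteq> [] \<Longrightarrow> ys \<noteq> [] \<Longrightarrow>
    path_edges (xs @ ys) = insert {last xs, hd ys} (path_edges xs \<union> path_edges ys)"
proof (induction xs)
  case (Cons x xs)
  then show ?case
    by (cases "xs = []") (auto simp: path_edges_Cons)
qed simp

lemma path_edges_rev: "path_edges (rev xs) = path_edges xs"
proof (induction xs)
  case (Cons x xs)
  then show ?case
    by (cases "xs = []") (auto simp: path_edges_Cons path_edges_append last_rev insert_commute)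
qed simp

lemma path_edges_take: "path_edges (take k xs) \<subseteq> path_edges xs"
  by (auto simp: path_edges_def)

lemma path_edges_drop: "path_edges (drop k xs) \<subseteq> path_edges xs"
  by (fastforce simp: path_edges_def)

lemma card_path_edges:
  assumes "distinct xs"
  shows "card (path_edges xs) = length xs - 1"
proof -
  have "inj_on (\<lambda>i. {xs ! i, xs ! Suc i}) {..<length xs - 1}"
    using assms by (auto simp: inj_on_def doubleton_eq_iff nth_eq_iff_index_eq)
  then show ?thesis unfolding path_edges_conv_image by (simp add: card_image)
qed

lemma cycle_edges_rotate1: "cycle_edges (rotate1 xs) = cycle_edges xs"
proof (cases xs)
  case (Cons x ys)
  then show ?thesis
    by (cases "ys = []") (auto simp: cycle_edges_def path_edges_Cons path_edges_append)
qed simp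

lemma cycle_edges_rotate: "cycle_edges (rotate r xs) = cycle_edges xs"
  by (induction r) (simp_all add: cycle_edges_rotate1)

lemma signed_cycle_rotate: "signed_cycle \<Gamma> (rotate r xs) = signed_cycle \<Gamma> xs"
  by (simp add: signed_cycle_def cycle_edges_rotate)

text \<open>Cuts a cycle open into a path that ends at a chosen vertex.\<close>

lemma ex_rotate_last:
  assumes "u \<in> set xs"
  obtains r where "last (rotate r xs) = u"
proof -
  obtain k where k: "k < length xs" "u = xs ! k" using assms by (auto simp: in_set_conv_nth)
  then have "last (rotate (Suc k) xs) = xs ! ((length xs - 1 + Suc k) mod length xs)"
    by (subst last_conv_nth) (auto simp: nth_rotate add.commute simp del: rotate_Suc)
  also have "length xs - 1 + Suc k = length xs + k" using k by simp
  also have "xs ! ((length xs + k) mod length xs) = u" using k by simp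
  finally show thesis by (rule that)
qed

section \<open>Maximal paths and the existence of closed path forms\<close>

definition gpath :: "('a, 'm) graph_scheme \<Rightarrow> 'a list \<Rightarrow> bool" where
  "gpath G vs \<longleftrightarrow> vs \<noteq> [] \<and> distinct vs \<and> set vs \<subseteq> verts G \<and> path_edges vs \<subseteq> edges G"

lemma gpath_snoc:
  assumes "gpath G vs" "w \<in> verts G" "w \<notin> set vs" "{last vs, w} \<in> edges G"
  shows "gpath G (vs @ [w])"
  using assms by (simp add: gpath_def path_edges_append)

lemma length_gpath_le: "simple_graph G \<Longrightarrow> gpath G vs \<Longrightarrow> length vs \<le> card (verts G)"
  unfolding gpath_def simple_graph_def by (metis card_mono distinct_card)

text \<open>The end vertex has a neighbour besides its predecessor on the path, and since the path
  cannot be extended, this neighbour lies on the path.\<close>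

lemma gpath_end_chord:
  assumes G: "simple_graph G" "\<And>v. v \<in> verts G \<Longrightarrow> 2 \<le> degree_of G v" and vs: "gpath G vs"
    and max: "\<And>w. w \<in> verts G \<Longrightarrow> w \<notin> set vs \<Longrightarrow> {last vs, w} \<notin> edges G"
  obtains j where "j + 2 < length vs" "{vs ! (length vs - 1), vs ! j} \<in> edges G"
proof -
  have ne: "vs \<noteq> []" and l: "last vs = vs ! (length vs - 1)"
    using vs by (auto simp: gpath_def last_conv_nth)
  have "last vs \<in> verts G" using vs by (auto simp: gpath_def)
  \<comment> \<open>For a path with a single vertex the index \<open>length vs - 2\<close> is 0 and
    denotes the end vertex itself; the exclusions below then leave no value for
    \<open>j\<close>.\<close>
  then obtain w where w: "w \<in> verts G" "w \<noteq> last vs" "w \<noteq> vs ! (length vs - 2)" "{last vs, w} \<in> edges G"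
    using ex_other_neighbour[OF G(1) G(2)] by metis
  then obtain j where j: "j < length vs" "w = vs ! j" using max by (auto simp: in_set_conv_nth)
  have "j \<noteq> length vs - 1" "j \<noteq> length vs - 2" using w j l by metis+
  then have "j + 2 < length vs" using j by linarith
  then show thesis using that w j l by metis
qed

lemma ex_longest:
  assumes "P (xs :: 'a list)" "\<And>ys. P ys \<Longrightarrow> length ys \<le> b"
  obtains zs where "P zs" "\<And>ys. P ys \<Longrightarrow> length ys \<le> length zs"
  using ex_has_greatest_nat[of P xs length "Suc b"] assms by (metis less_Suc_eq_le)

text \<open>The end chord of a longest path closes a final segment of it to a cycle.\<close>

lemma ex_cycle:
  assumes "simple_graph G" "leaf_free G" "bicyclic G"
  obtains C where "is_cycle G C"
proof -
  note deg = min_degree_bicyclic[OF assms]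
  obtain v where "v \<in> verts G" using assms(3) by (auto simp: bicyclic_def connected_graph_def)
  then have "gpath G [v]" by (simp add: gpath_def)
  then obtain vs where vs: "gpath G vs" and max: "\<And>ys. gpath G ys \<Longrightarrow> length ys \<le> length vs"
    using ex_longest[of "gpath G" "[v]" "card (verts G)"] length_gpath_le[OF assms(1)] by metis
  have "{last vs, w} \<notin> edges G" if "w \<in> verts G" "w \<notin> set vs" for w
    using gpath_snoc[OF vs that] max[of "vs @ [w]"] by auto
  then obtain j where j: "j + 2 < length vs" "{vs ! (length vs - 1), vs ! j} \<in> edges G"
    using gpath_end_chord[OF assms(1) deg vs] by metis
  have "last (drop j vs) = vs ! (length vs - 1)" "hd (drop j vs) = vs ! j"
    using j by (auto simp: last_conv_nth hd_drop_conv_nth)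
  then have "is_cycle G (drop j vs)"
    using vs j path_edges_drop[of j vs] set_drop_subset[of j vs]
    by (auto simp: is_cycle_def cycle_edges_def gpath_def)
  then show thesis by (rule that)
qed

text \<open>The path with its two chords is a subgraph with one more edge than vertices, and
  \<open>bicyclic_subgraph_eq\<close> identifies it with \<open>G\<close>.\<close>

lemma closed_path_formI:
  assumes G: "simple_graph G" "leaf_free G" "bicyclic G" and vs: "gpath G vs"
    and ij: "2 \<le> i" "i < length vs" "j + 2 < length vs" "\<not> (Suc i = length vs \<and> j = 0)"
    and chords: "{vs ! 0, vs ! i} \<in> edges G" "{vs ! (length vs - 1), vs ! j} \<in> edges G"
  shows "closed_path_form G vs i j"
proof -
  define E where "E = insert {vs ! 0, vs ! i} (insert {vs ! (length vs - 1), vs ! j} (path_edges vs))"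
  define H :: "'a graph" where "H = \<lparr>verts = set vs, edges = E\<rparr>"
  have d: "distinct vs" using vs by (simp add: gpath_def)
  have "finite (path_edges vs)" by (simp add: path_edges_conv_image)
  then have "card E = card (set vs) + 1"
    using closed_path_form_chords[OF d ij] card_path_edges[OF d] distinct_card[OF d] ij
    by (simp add: E_def)
  moreover have "simple_graph H"
  proof -
    have "\<exists>u\<in>set vs. \<exists>v\<in>set vs. u \<noteq> v \<and> e = {u, v}" if e: "e \<in> E" for e
    proof -
      obtain k m where "k < length vs" "m < length vs" "k \<noteq> m" "e = {vs ! k, vs ! m}"
      proof -
        consider "e = {vs ! 0, vs ! i}" | "e = {vs ! (length vs - 1), vs ! j}"
          | k where "Suc k < length vs" "e = {vs ! k, vs ! Suc k}"
          using e by (auto simp: E_def path_edges_def)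
        then show ?thesis
        proof cases
          case 1
          then show ?thesis using ij by (intro that[of 0 i]) auto
        next
          case 2
          then show ?thesis using ij by (intro that[of "length vs - 1" j]) auto
        next
          case (3 k)
          then show ?thesis by (intro that[of k "Suc k"]) auto
        qed
      qed
      then show ?thesis using d nth_eq_iff_index_eq nth_mem by metis
    qed
    then show ?thesis by (simp add: H_def simple_graph_def)
  qed
  ultimately have "verts H = verts G" "edges H = edges G"
    using bicyclic_subgraph_eq[OF G(1,3) min_degree_bicyclic[OF G], of H] vs chords
    by (auto simp: H_def E_def gpath_def)
  then show ?thesis
    using d ij by (simp add: closed_path_form_def H_def E_def)
qed

text \<open>A longest path that begins with a rotation of \<open>C\<close> ends either outside
  \<open>C\<close>, where \<open>gpath_end_chord\<close> supplies the second chord, or on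
  \<open>C\<close>; in the latter case \<open>C\<close> is spanning and an edge off \<open>C\<close>
  is the second chord.\<close>

lemma ex_closed_path_form:
  assumes G: "simple_graph G" "leaf_free G" "bicyclic G" and C: "is_cycle G C"
  obtains vs j r where "closed_path_form G vs (length C - 1) j" "take (length C) vs = rotate r C"
proof -
  note result = that
  note deg = min_degree_bicyclic[OF G]
  have C3: "3 \<le> length C" "distinct C" "set C \<subseteq> verts G" "cycle_edges C \<subseteq> edges G"
    using C by (auto simp: is_cycle_def)
  then have ne: "C \<noteq> []" by auto
  have rot: "gpath G (rotate r C)" for r
  proof -
    have "path_edges (rotate r C) \<subseteq> cycle_edges C"
      using cycle_edges_rotate[of r C] unfolding cycle_edges_def by blast
    then show ?thesis using C3 ne by (auto simp: gpath_def)
  qed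
  \<comment> \<open>All rotations compete for the maximum. If no rotation can be extended, then no
    vertex of \<open>C\<close> has a neighbour outside \<open>C\<close>.\<close>
  define P where "P vs \<longleftrightarrow> gpath G vs \<and> (\<exists>r ys. vs = rotate r C @ ys)" for vs
  have Prot: "P (rotate r C)" for r using rot by (auto simp: P_def)
  obtain vs where vs: "P vs" and max: "\<And>us. P us \<Longrightarrow> length us \<le> length vs"
    using ex_longest[of P "rotate 0 C" "card (verts G)"] Prot length_gpath_le[OF G(1)]
    unfolding P_def by metis
  have no_ext: "{last us, w} \<notin> edges G"
    if "P us" "length us = length vs" "w \<in> verts G" "w \<notin> set us" for us w
  proof
    assume "{last us, w} \<in> edges G"
    then have "P (us @ [w])" using that gpath_snoc[of G us w] by (auto simp: P_def)
    then show False using max that(2) by fastforce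
  qed
  have fin: thesis
    if us: "gpath G us" "us = rotate r C @ ys" and j: "j + 2 < length us"
      "\<not> (length C = length us \<and> j = 0)" "{us ! (length us - 1), us ! j} \<in> edges G" for us r ys j
  proof -
    have "us ! 0 = hd (rotate r C)" "us ! (length C - 1) = last (rotate r C)"
      using us ne by (simp_all add: nth_append hd_conv_nth last_conv_nth)
    moreover have "{last (rotate r C), hd (rotate r C)} \<in> cycle_edges (rotate r C)"
      by (simp add: cycle_edges_def)
    ultimately have chord: "{us ! 0, us ! (length C - 1)} \<in> edges G"
      using C3(4) cycle_edges_rotate[of r C] by (auto simp: insert_commute)
    have le: "length C \<le> length us" using us by simp
    have "closed_path_form G us (length C - 1) j"
      by (rule closed_path_formI[OF G us(1)]) (use C3(1) j chord le in auto)
    then show thesis by (rule result) (use us in simp)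
  qed
  obtain r ys where vs': "gpath G vs" "vs = rotate r C @ ys" using vs by (auto simp: P_def)
  show thesis
  proof (cases "ys = []")
    case False
    obtain j where "j + 2 < length vs" "{vs ! (length vs - 1), vs ! j} \<in> edges G"
      using gpath_end_chord[OF G(1) deg vs'(1)] no_ext[OF vs] by metis
    then show thesis using fin[OF vs'] vs'(2) False by simp
  next
    case True
    then have len: "length vs = length C" using vs' by simp
    have V: "set C = verts G"
    proof (rule connected_closed_set)
      show "connected_graph G" using G(3) by (simp add: bicyclic_def)
      fix u w assume u: "u \<in> set C" and uw: "{u, w} \<in> edges G"
      obtain r where "last (rotate r C) = u" using ex_rotate_last[OF u] .
      moreover have "w \<in> verts G"
        using G(1) uw unfolding simple_graph_def by (fastforce simp: doubleton_eq_iff)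
      ultimately show "w \<in> set C" using no_ext[OF Prot, of r w] uw len by auto
    qed (use C3 ne in auto)
    \<comment> \<open>A spanning cycle has at most as many edges as \<open>G\<close> has vertices,
      so the bicyclic graph \<open>G\<close> has a further edge.\<close>
    have "card (cycle_edges C) \<le> length C"
      unfolding cycle_edges_def using card_path_edges[OF C3(2)] C3(1) by (intro card_insert_le_m1) auto
    moreover have "card (edges G) = length C + 1"
      using G(3) V distinct_card[OF C3(2)] by (simp add: bicyclic_def)
    ultimately have "edges G \<noteq> cycle_edges C" by auto
    then obtain e where e: "e \<in> edges G" "e \<notin> cycle_edges C" using C3(4) by blast
    then obtain u w where uw: "u \<in> set C" "w \<in> set C" "u \<noteq> w" "e = {u, w}"
      using G(1) unfolding simple_graph_def V[symmetric] by blast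
    \<comment> \<open>Rotating one end of the extra edge to the last position turns this edge into
      the chord at the end of the path, while the closing edge of the cycle becomes the chord at its
      start.\<close>
    obtain r' where r': "last (rotate r' C) = u" using ex_rotate_last[OF uw(1)] .
    define us where "us = rotate r' C"
    obtain j where j: "j < length us" "w = us ! j"
      using uw(2) unfolding us_def by (metis in_set_conv_nth set_rotate)
    have us: "us \<noteq> []" "length us = length C" "u = us ! (length us - 1)"
      using ne r' by (auto simp: us_def last_conv_nth)
    have nc: "{u, w} \<notin> cycle_edges us"
      using e uw cycle_edges_rotate[of r' C] by (simp add: us_def)
    \<comment> \<open>The other end \<open>w\<close> differs from \<open>u\<close> and is not one of
      its two neighbours on the cycle, which excludes the last index, index 0 and the last index but
      one.\<close>
    have "j \<noteq> length us - 1" using j us uw by metis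
    moreover have "j \<noteq> 0" using nc us j by (auto simp: cycle_edges_def last_conv_nth hd_conv_nth)
    moreover have "Suc j \<noteq> length us - 1"
      using nc us j by (auto simp: cycle_edges_def path_edges_def insert_commute)
    ultimately have "j + 2 < length us" using j(1) by linarith
    then show thesis
      using fin[of us r' "[]" j] rot[of r'] e(1) uw(4) us j \<open>j \<noteq> 0\<close> by (simp add: us_def)
  qed
qed

section \<open>Closed path forms and isomorphism\<close>

lemma closed_path_form_adjacent:
  assumes "closed_path_form G vs i j" "k < length vs" "m < length vs"
  shows "{vs ! k, vs ! m} \<in> edges G \<longleftrightarrow>
    m = Suc k \<or> k = Suc m \<or> {k, m} = {0, i} \<or> {k, m} = {length vs - 1, j}"
proof -
  have d: "distinct vs" and l: "0 < length vs" "i < length vs" "length vs - 1 < length vs" "j < length vs"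
    and E: "edges G = insert {vs ! 0, vs ! i} (insert {vs ! (length vs - 1), vs ! j} (path_edges vs))"
    using assms(1) by (auto simp: closed_path_form_def)
  have eq: "{vs ! k, vs ! m} = {vs ! a, vs ! b} \<longleftrightarrow> {k, m} = {a, b}"
    if "a < length vs" "b < length vs" for a b
    using that assms d by (simp add: doubleton_eq_iff nth_eq_iff_index_eq)
  show ?thesis
    unfolding E insert_iff path_edges_nth_iff[OF d assms(2,3)] eq[OF l(1,2)] eq[OF l(3,4)] by argo
qed

lemma closed_path_form_adjacentI:
  assumes G: "simple_graph G" and vs: "distinct vs" "verts G = set vs"
    and ij: "2 \<le> i" "i < length vs" "j + 2 < length vs" "\<not> (Suc i = length vs \<and> j = 0)"
    and adj: "\<And>k m. k < length vs \<Longrightarrow> m < length vs \<Longrightarrow> {vs ! k, vs ! m} \<in> edges G \<longleftrightarrow>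
      m = Suc k \<or> k = Suc m \<or> {k, m} = {0, i} \<or> {k, m} = {length vs - 1, j}"
  shows "closed_path_form G vs i j"
proof -
  let ?E = "insert {vs ! 0, vs ! i} (insert {vs ! (length vs - 1), vs ! j} (path_edges vs))"
  have "edges G \<subseteq> ?E"
  proof
    fix e assume e: "e \<in> edges G"
    then obtain u v where "u \<in> set vs" "v \<in> set vs" "e = {u, v}"
      using G unfolding simple_graph_def vs(2) by blast
    then obtain k m where km: "k < length vs" "m < length vs" "e = {vs ! k, vs ! m}"
      by (metis in_set_conv_nth)
    consider "m = Suc k \<or> k = Suc m" | "{k, m} = {0, i}" | "{k, m} = {length vs - 1, j}"
      using adj[OF km(1,2)] e unfolding km(3) by argo
    then show "e \<in> ?E"
    proof cases
      case 1
      then show ?thesis using path_edges_nth_iff[OF vs(1) km(1,2)] km(3) by simp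
    next
      case 2
      then have "e = {vs ! 0, vs ! i}" unfolding km(3) by (auto simp: doubleton_eq_iff)
      then show ?thesis by simp
    next
      case 3
      then have "e = {vs ! (length vs - 1), vs ! j}" unfolding km(3) by (auto simp: doubleton_eq_iff)
      then show ?thesis by simp
    qed
  qed
  moreover have "?E \<subseteq> edges G"
  proof -
    have "0 < length vs" "length vs - 1 < length vs" "j < length vs" using ij by auto
    then have "{vs ! 0, vs ! i} \<in> edges G" "{vs ! (length vs - 1), vs ! j} \<in> edges G"
      using adj[of 0 i] adj[of "length vs - 1" j] ij(2) by simp_all
    moreover have "path_edges vs \<subseteq> edges G"
      using adj by (auto simp: path_edges_def)
    ultimately show ?thesis by blast
  qed
  ultimately show ?thesis using vs ij by (auto simp: closed_path_form_def)
qed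

text \<open>Adjacency of path positions depends only on \<open>i\<close>, \<open>j\<close> and the
  length, so matching equal positions of the two paths is an isomorphism.\<close>

lemma graph_iso_closed_path_form:
  assumes G: "closed_path_form G vs i j" and H: "closed_path_form H ws i j"
    and len: "length vs = length ws"
  shows "G \<cong>\<^sub>G H"
proof -
  have d: "distinct vs" "verts G = set vs" "distinct ws" "verts H = set ws"
    using G H by (auto simp: closed_path_form_def)
  define r where "r = the_inv_into {..<length vs} ((!) vs)"
  have bij: "bij_betw ((!) vs) {..<length vs} (set vs)" "bij_betw ((!) ws) {..<length vs} (set ws)"
    using d len by (auto intro!: bij_betw_nth)
  have rv: "r (vs ! k) = k" if "k < length vs" for k
    unfolding r_def using bij(1) that by (intro the_inv_into_f_f) (auto simp: bij_betw_def)
  have "bij_betw ((!) ws \<circ> r) (set vs) (set ws)"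
    using bij_betw_trans[OF bij_betw_the_inv_into[OF bij(1)] bij(2)] by (simp add: r_def)
  moreover have "{u, v} \<in> edges G \<longleftrightarrow> {((!) ws \<circ> r) u, ((!) ws \<circ> r) v} \<in> edges H"
    if uv: "u \<in> set vs" "v \<in> set vs" for u v
  proof -
    obtain k where k: "k < length vs" "u = vs ! k" using uv(1) by (auto simp: in_set_conv_nth)
    obtain m where m: "m < length vs" "v = vs ! m" using uv(2) by (auto simp: in_set_conv_nth)
    show ?thesis
      unfolding k(2) m(2) comp_apply rv[OF k(1)] rv[OF m(1)] closed_path_form_adjacent[OF G k(1) m(1)]
        closed_path_form_adjacent[OF H k(1)[unfolded len] m(1)[unfolded len]] len ..
  qed
  ultimately show ?thesis unfolding graph_iso_def d by blast
qed

lemma closed_path_form_iso: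
  assumes iso: "G \<cong>\<^sub>G H" and G: "simple_graph G" and H: "closed_path_form H ws i j"
  obtains vs where "closed_path_form G vs i j" "length vs = length ws"
proof -
  obtain f where f: "bij_betw f (verts G) (verts H)"
    and fe: "\<And>u v. u \<in> verts G \<Longrightarrow> v \<in> verts G \<Longrightarrow> {u, v} \<in> edges G \<longleftrightarrow> {f u, f v} \<in> edges H"
    using iso unfolding graph_iso_def by blast
  have ws: "distinct ws" "verts H = set ws" and ij: "2 \<le> i" "i < length ws" "j + 2 < length ws"
      "\<not> (Suc i = length ws \<and> j = 0)"
    using H by (auto simp: closed_path_form_def)
  define g where "g = the_inv_into (verts G) f"
  have g: "bij_betw g (set ws) (verts G)"
    unfolding g_def using bij_betw_the_inv_into[OF f] ws by simp
  have fg: "f (g w) = w" if "w \<in> set ws" for w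
    unfolding g_def using f that ws by (intro f_the_inv_into_f) (auto simp: bij_betw_def)
  have gv: "g w \<in> verts G" if "w \<in> set ws" for w using g that by (auto simp: bij_betw_def)
  have "closed_path_form G (map g ws) i j"
  proof (rule closed_path_form_adjacentI[OF G])
    show "distinct (map g ws)" "verts G = set (map g ws)"
      using g ws by (auto simp: distinct_map bij_betw_def)
    show "{map g ws ! k, map g ws ! m} \<in> edges G \<longleftrightarrow> m = Suc k \<or> k = Suc m \<or>
        {k, m} = {0, i} \<or> {k, m} = {length (map g ws) - 1, j}"
      if "k < length (map g ws)" "m < length (map g ws)" for k m
    proof -
      have km: "k < length ws" "m < length ws" using that by auto
      have "{g (ws ! k), g (ws ! m)} \<in> edges G \<longleftrightarrow> {ws ! k, ws ! m} \<in> edges H"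
        using fe[OF gv gv] fg km by simp
      then show ?thesis
        unfolding closed_path_form_adjacent[OF H km] nth_map[OF km(1)] nth_map[OF km(2)] length_map .
    qed
  qed (use ij in auto)
  then show thesis using that by simp
qed

section \<open>The two families in closed path form\<close>

lemma path_edges_append_overlap:
  "path_edges (xs @ a # ys) = path_edges (xs @ [a]) \<union> path_edges (a # ys)"
proof (cases "xs = []")
  case False
  then show ?thesis using path_edges_append[of xs "a # ys"] path_edges_append[of xs "[a]"] by simp
qed simp

text \<open>The path \<open>ws\<close> runs through the first cycle up to its attachment vertex 0,
  along the connecting path to \<open>l - 1\<close>, and then through the second cycle. The chords
  are the missing closing edges of the two cycles.\<close>

lemma closed_path_form_infinity:
  assumes "infinity_params p q l"
  obtains ws where "closed_path_form (infinity_graph p q l) ws (p - 1) (p + l - 2)"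
    "length ws = p + q + l - 2"
proof -
  have pql: "3 \<le> p" "3 \<le> q" "1 \<le> l" using assms by (auto simp: infinity_params_def)
  define X Y where "X = [l..<l + p - 1]" and "Y = [l + p - 1..<l + p + q - 2]"
  define ws where "ws = X @ [0..<l] @ Y"
  have ne: "X \<noteq> []" "Y \<noteq> []" "[0..<l] \<noteq> []" using pql by (auto simp: X_def Y_def)
  have len: "length X = p - 1" "length Y = q - 1" "length ws = p + q + l - 2"
    using pql by (auto simp: X_def Y_def ws_def)
  have ends: "hd [0..<l] = 0" "last [0..<l] = l - 1" using ne by (auto simp: hd_conv_nth last_conv_nth)
  have nth: "ws ! 0 = hd X" "ws ! (p - 1) = 0" "ws ! (length ws - 1) = last Y" "ws ! (p + l - 2) = l - 1"
  proof -
    show "ws ! 0 = hd X" using ne by (simp add: ws_def nth_append hd_conv_nth)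
    show "ws ! (p - 1) = 0" using len pql by (simp add: ws_def nth_append)
    have "last ws = last Y" using ne by (simp add: ws_def)
    then show "ws ! (length ws - 1) = last Y" using last_conv_nth[of ws] ne by (simp add: ws_def)
    have "p + l - 2 = length X + (l - 1)" using len pql by simp
    then show "ws ! (p + l - 2) = l - 1" using pql by (simp add: ws_def nth_append)
  qed
  have pe: "path_edges ws =
      insert {last X, 0} (path_edges X \<union> insert {l - 1, hd Y} (path_edges [0..<l] \<union> path_edges Y))"
    unfolding ws_def
    using path_edges_append[of X "[0..<l] @ Y"] path_edges_append[of "[0..<l]" Y] ne ends by simp
  have ce: "cycle_edges (0 # X) = insert {last X, 0} (insert {hd X, 0} (path_edges X))"
    "cycle_edges ((l - 1) # Y) = insert {last Y, l - 1} (insert {l - 1, hd Y} (path_edges Y))"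
    using ne by (simp_all add: cycle_edges_def path_edges_Cons doubleton_eq_iff insert_commute[of 0])
  have sets: "A \<union> insert a (insert b B) \<union> insert c (insert d D) =
      insert b (insert c (insert a (B \<union> insert d (A \<union> D))))" for a b c d :: "nat set" and A B D
    by blast
  have "edges (infinity_graph p q l) = path_edges [0..<l] \<union> cycle_edges (0 # X) \<union> cycle_edges ((l - 1) # Y)"
    by (simp add: infinity_graph_def X_def Y_def)
  also have "\<dots> =
      insert {ws ! 0, ws ! (p - 1)} (insert {ws ! (length ws - 1), ws ! (p + l - 2)} (path_edges ws))"
    unfolding nth pe ce by (rule sets)
  finally have "edges (infinity_graph p q l) =
      insert {ws ! 0, ws ! (p - 1)} (insert {ws ! (length ws - 1), ws ! (p + l - 2)} (path_edges ws))" .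
  moreover have "distinct ws" "verts (infinity_graph p q l) = set ws"
    using pql by (auto simp: ws_def X_def Y_def infinity_graph_def)
  moreover have "2 \<le> p - 1" "p - 1 < length ws" "p + l - 2 + 2 < length ws"
    "\<not> (Suc (p - 1) = length ws \<and> p + l - 2 = 0)"
    using pql len by linarith+
  ultimately have "closed_path_form (infinity_graph p q l) ws (p - 1) (p + l - 2)"
    unfolding closed_path_form_def by (intro conjI)
  then show thesis using that len by blast
qed

text \<open>The path \<open>ws\<close> starts next to vertex 1 on the second branch, runs back to 0,
  takes the first branch to 1, and follows the third branch backwards until just before 0. The
  chords are the missing last edge of the second branch and the missing first edge of the
  third.\<close>

lemma closed_path_form_theta:
  assumes "theta_params p q l"
  obtains ws where "closed_path_form (theta_graph p q l) ws (p + q - 1) (q - 1)"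
    "length ws = p + q + l - 1"
proof -
  have pql: "1 \<le> p" "1 \<le> q" "1 \<le> l" "p + q \<ge> 3" "p + l \<ge> 3" "q + l \<ge> 3"
    using assms by (auto simp: theta_params_def)
  define P Q R where "P = [2..<p + 1]" and "Q = [p + 1..<p + q]" and "R = [p + q..<p + q + l - 1]"
  define ws where "ws = rev Q @ 0 # P @ 1 # rev R"
  have len: "length P = p - 1" "length Q = q - 1" "length R = l - 1" "length ws = p + q + l - 1"
    using pql by (auto simp: P_def Q_def R_def ws_def)
  \<comment> \<open>The forms \<open>last (0 # Q)\<close> and \<open>hd (R @ [1])\<close> also cover
    branches of length 1, where \<open>Q\<close> or \<open>R\<close> is empty and the path starts at
    0 or ends at 1.\<close>
  have nth: "ws ! 0 = last (0 # Q)" "ws ! (p + q - 1) = 1" "ws ! (length ws - 1) = hd (R @ [1])"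
    "ws ! (q - 1) = 0"
  proof -
    show "ws ! 0 = last (0 # Q)" by (simp add: ws_def nth_append hd_conv_nth[symmetric] hd_rev)
    have "p + q - 1 = length (rev Q @ 0 # P)" using len pql by simp
    moreover have "ws = (rev Q @ 0 # P) @ 1 # rev R" by (simp add: ws_def)
    ultimately show "ws ! (p + q - 1) = 1" by (metis nth_append_length)
    have "last ws = hd (R @ [1])" by (simp add: ws_def last_rev hd_append)
    then show "ws ! (length ws - 1) = hd (R @ [1])" using last_conv_nth[of ws] by (simp add: ws_def)
    show "ws ! (q - 1) = 0" using len by (metis length_rev nth_append_length ws_def)
  qed
  have "path_edges ws = path_edges (rev Q @ [0]) \<union> path_edges (0 # P @ [1]) \<union> path_edges (1 # rev R)"
    unfolding ws_def
    using path_edges_append_overlap[of "rev Q" 0 "P @ 1 # rev R"] path_edges_append_overlap[of "0 # P" 1 "rev R"]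
    by auto
  also have "path_edges (rev Q @ [0]) = path_edges (0 # Q)" using path_edges_rev[of "0 # Q"] by simp
  also have "path_edges (1 # rev R) = path_edges (R @ [1])" using path_edges_rev[of "R @ [1]"] by simp
  finally have pe: "path_edges ws = path_edges (0 # Q) \<union> path_edges (0 # P @ [1]) \<union> path_edges (R @ [1])" .
  have pQ: "path_edges (0 # Q @ [1]) = insert {last (0 # Q), 1} (path_edges (0 # Q))"
    using path_edges_append[of "0 # Q" "[1]"] by simp
  have pR: "path_edges (0 # R @ [1]) = insert {hd (R @ [1]), 0} (path_edges (R @ [1]))"
    using path_edges_Cons[of "R @ [1]" 0] by (simp add: insert_commute)
  have sets: "A \<union> insert b B \<union> insert c C = insert b (insert c (B \<union> A \<union> C))"
    for b c :: "nat set" and A B C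
    by blast
  have "edges (theta_graph p q l) =
      path_edges (0 # P @ [1]) \<union> path_edges (0 # Q @ [1]) \<union> path_edges (0 # R @ [1])"
    by (simp add: theta_graph_def P_def Q_def R_def)
  also have "\<dots> =
      insert {ws ! 0, ws ! (p + q - 1)} (insert {ws ! (length ws - 1), ws ! (q - 1)} (path_edges ws))"
    unfolding nth pe pQ pR by (rule sets)
  finally have "edges (theta_graph p q l) =
      insert {ws ! 0, ws ! (p + q - 1)} (insert {ws ! (length ws - 1), ws ! (q - 1)} (path_edges ws))" .
  moreover have "distinct ws" "verts (theta_graph p q l) = set ws"
    using pql by (auto simp: ws_def P_def Q_def R_def theta_graph_def)
  moreover have "2 \<le> p + q - 1" "p + q - 1 < length ws" "q - 1 + 2 < length ws"
    "\<not> (Suc (p + q - 1) = length ws \<and> q - 1 = 0)"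
    using pql len by linarith+
  ultimately have "closed_path_form (theta_graph p q l) ws (p + q - 1) (q - 1)"
    unfolding closed_path_form_def by (intro conjI)
  then show thesis using that len by blast
qed

text \<open>Makes the hypothesis on all cycles of the graph applicable to the two cycles in
  \<open>nullity_closed_path_form\<close>.\<close>

lemma closed_path_form_cycles:
  assumes "closed_path_form G vs i j"
  shows "is_cycle G (take (Suc i) vs)" "is_cycle G (drop j vs)"
proof -
  have d: "distinct vs" "verts G = set vs" and ij: "2 \<le> i" "i < length vs" "j + 2 < length vs"
    and E: "edges G = insert {vs ! 0, vs ! i} (insert {vs ! (length vs - 1), vs ! j} (path_edges vs))"
    using assms by (auto simp: closed_path_form_def)
  have ne: "vs \<noteq> []" using ij by auto
  have "last (take (Suc i) vs) = vs ! i" "hd (take (Suc i) vs) = vs ! 0"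
    using ij ne by (simp_all add: take_Suc_conv_app_nth hd_conv_nth hd_append)
  then have "cycle_edges (take (Suc i) vs) \<subseteq> edges G"
    unfolding E cycle_edges_def using path_edges_take[of "Suc i" vs] by (auto simp: insert_commute)
  then show "is_cycle G (take (Suc i) vs)"
    using d ij set_take_subset[of "Suc i" vs] by (simp add: is_cycle_def)
  have "last (drop j vs) = vs ! (length vs - 1)" "hd (drop j vs) = vs ! j"
    using ij ne by (simp_all add: last_conv_nth hd_drop_conv_nth)
  then have "cycle_edges (drop j vs) \<subseteq> edges G"
    unfolding E cycle_edges_def using path_edges_drop[of j vs] by auto
  then show "is_cycle G (drop j vs)"
    using d ij set_drop_subset[of j vs] by (simp add: is_cycle_def)
qed

section \<open>Cyclomatic number two and the characterisation of nullity three\<close>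

lemma cyclomatic_number_bicyclic:
  assumes "bicyclic G"
  shows "cyclomatic_number G = 2"
proof -
  have "conn_rel G = verts G \<times> verts G" "verts G \<noteq> {}"
    using assms by (auto simp: bicyclic_def connected_graph_def conn_rel_def)
  then have "components G = {verts G}"
    by (auto simp: components_def quotient_def)
  then show ?thesis using assms by (simp add: cyclomatic_number_def bicyclic_def)
qed

theorem theorem5p2:
  fixes \<Gamma> :: "'a signed_graph"
  assumes "simple_graph \<Gamma>"
    and "leaf_free \<Gamma>"
    and "bicyclic \<Gamma>"
  shows "(int (nullity \<Gamma>) = 2 * cyclomatic_number \<Gamma> - 1 \<and> 2 * cyclomatic_number \<Gamma> - 1 = 3)
    \<longleftrightarrow>
      ((\<exists>l k x. infinity_params l k x \<and> \<Gamma> \<cong>\<^sub>G infinity_graph l k x \<and>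
          (\<forall>C. is_cycle \<Gamma> C \<longrightarrow> nullity (signed_cycle \<Gamma> C) = 2) \<and> odd x)
     \<or> (\<exists>l' x' k'. theta_params l' x' k' \<and> \<Gamma> \<cong>\<^sub>G theta_graph l' x' k' \<and>
          (\<forall>C. is_cycle \<Gamma> C \<longrightarrow> nullity (signed_cycle \<Gamma> C) = 2) \<and>
          even l' \<and> even x' \<and> even k'))"
    (is "?null \<longleftrightarrow> ?inf \<or> ?theta")
proof
  assume ?null
  then have null: "nullity \<Gamma> = 3" by linarith
  have cyc: "\<forall>C. is_cycle \<Gamma> C \<longrightarrow> nullity (signed_cycle \<Gamma> C) = 2"
  proof (intro allI impI)
    fix C assume C: "is_cycle \<Gamma> C"
    then have "Suc (length C - 1) = length C" by (auto simp: is_cycle_def)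
    \<comment> \<open>Each cycle gets a closed path form of its own in which it is, up to rotation,
      the initial cycle, so the nullity criterion applies to it.\<close>
    moreover obtain vs j r where "closed_path_form \<Gamma> vs (length C - 1) j" "take (length C) vs = rotate r C"
      using ex_closed_path_form[OF assms C] .
    ultimately show "nullity (signed_cycle \<Gamma> C) = 2"
      using null nullity_closed_path_form[of \<Gamma> vs "length C - 1" j] signed_cycle_rotate[of \<Gamma> r C] by simp
  qed
  obtain C where "is_cycle \<Gamma> C" using ex_cycle[OF assms] .
  then obtain vs i j where form: "closed_path_form \<Gamma> vs i j"
    using ex_closed_path_form[OF assms] by metis
  define n where "n = length vs - 1"
  have ij: "2 \<le> i" "i \<le> n" "j + 2 \<le> n" and len: "length vs = Suc n"
    using form by (auto simp: closed_path_form_def n_def)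
  have par: "even n" "odd i" "odd j"
    using nullity_closed_path_form_iff[OF form] null by (auto simp: n_def)
  show "?inf \<or> ?theta"
  proof (cases "i \<le> j")
    case True
    \<comment> \<open>The numbers of vertices at indices 0 to \<open>i\<close>, \<open>j\<close> to
      \<open>n\<close>, and \<open>i\<close> to \<open>j\<close>.\<close>
    let ?p = "Suc i" and ?q = "Suc (n - j)" and ?l = "Suc (j - i)"
    have params: "infinity_params ?p ?q ?l" using ij by (simp add: infinity_params_def)
    have idx: "?p - 1 = i" "?p + ?l - 2 = j" "?p + ?q + ?l - 2 = length vs" using ij len True by auto
    obtain ws where "closed_path_form (infinity_graph ?p ?q ?l) ws i j" "length ws = length vs"
      using closed_path_form_infinity[OF params] unfolding idx .
    then have "\<Gamma> \<cong>\<^sub>G infinity_graph ?p ?q ?l" using graph_iso_closed_path_form[OF form] by metis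
    moreover have "odd ?l" using par True by simp
    ultimately show ?thesis using params cyc by blast
  next
    case False
    \<comment> \<open>Branch lengths between the vertices at \<open>j\<close> and \<open>i\<close>:
      the segment between them, the initial segment up to \<open>j\<close> with the first chord, and
      the final segment from \<open>i\<close> with the second chord.\<close>
    let ?p = "i - j" and ?q = "Suc j" and ?l = "Suc (n - i)"
    \<comment> \<open>Since \<open>j\<close> is odd, it is at least 1, and since \<open>i\<close>
      and \<open>n\<close> differ in parity, \<open>i < n\<close>; so the last two branches have
      length at least 2.\<close>
    have params: "theta_params ?p ?q ?l" using ij False par by (auto simp: theta_params_def)
    have idx: "?p + ?q - 1 = i" "?q - 1 = j" "?p + ?q + ?l - 1 = length vs" using ij len False by auto
    obtain ws where "closed_path_form (theta_graph ?p ?q ?l) ws i j" "length ws = length vs"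
      using closed_path_form_theta[OF params] unfolding idx .
    then have "\<Gamma> \<cong>\<^sub>G theta_graph ?p ?q ?l" using graph_iso_closed_path_form[OF form] by metis
    moreover have "even ?p" "even ?q" "even ?l" using par False ij by auto
    ultimately show ?thesis using params cyc by blast
  qed
next
  have fin: "?null" if "closed_path_form \<Gamma> vs i j" "even (i + j)"
    "\<forall>C. is_cycle \<Gamma> C \<longrightarrow> nullity (signed_cycle \<Gamma> C) = 2" for vs i j
    using nullity_closed_path_form[OF that(1)] that(2,3) closed_path_form_cycles[OF that(1)]
      cyclomatic_number_bicyclic[OF assms(3)] by simp
  assume "?inf \<or> ?theta"
  then show ?null
  proof
    assume ?inf
    then obtain p q l where pql: "infinity_params p q l" "\<Gamma> \<cong>\<^sub>G infinity_graph p q l" "odd l"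
      and cyc: "\<forall>C. is_cycle \<Gamma> C \<longrightarrow> nullity (signed_cycle \<Gamma> C) = 2" by blast
    obtain vs where "closed_path_form \<Gamma> vs (p - 1) (p + l - 2)"
      using closed_path_form_iso[OF pql(2) assms(1)] closed_path_form_infinity[OF pql(1)] by metis
    \<comment> \<open>The index sum has the parity of \<open>l - 1\<close>, so an odd number of
      vertices on the connecting path makes it even.\<close>
    moreover have "p - 1 + (p + l - 2) = 2 * (p - 1) + (l - 1)"
      using pql(1) unfolding infinity_params_def by linarith
    then have "even (p - 1 + (p + l - 2))" using pql(3) by simp
    ultimately show ?null using fin cyc by blast
  next
    assume ?theta
    then obtain p q l where pql: "theta_params p q l" "\<Gamma> \<cong>\<^sub>G theta_graph p q l" "even p"
      and cyc: "\<forall>C. is_cycle \<Gamma> C \<longrightarrow> nullity (signed_cycle \<Gamma> C) = 2" by blast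
    obtain vs where "closed_path_form \<Gamma> vs (p + q - 1) (q - 1)"
      using closed_path_form_iso[OF pql(2) assms(1)] closed_path_form_theta[OF pql(1)] by metis
    moreover have "p + q - 1 + (q - 1) = 2 * (q - 1) + p"
      using pql(1) unfolding theta_params_def by linarith
    then have "even (p + q - 1 + (q - 1))" using pql(3) by simp
    ultimately show ?null using fin cyc by blast
  qed
qed

end
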